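(* Let $\Sigma$ be an X-network. Then there exists an extended system $\hat\Sigma$ of $\Sigma$, composed of subsystems with homogeneous internal dynamics, which is structurally controllable, and this $\hat\Sigma$ is structurally output controllable.
   Context: **Original network.** $\Sigma$ is the structured system $\dot x=Ax+Bu$, $y=x$ (so the output matrix is $C=I_n$), with $x\in\mathbb{R}^n$, $u\in\mathbb{R}^m$. Each entry of $A\in\mathbb{R}^{n\times n}$ and $B\in\mathbb{R}^{n\times m}$ is either fixed to zero or a free (independent, arbitrary real) parameter, and all diagonal entries of $A$ are fixed to zero. The $i$-th component $x_i$ is the state of the $i$-th (first-order) subsystem; $a_{ij}$ ($i\neq j$) are the off-diagonal entries of $A$ and $b_{i,s}$ the entries of $B$. For entries of a structured matrix, "$\neq 0$" means "is a free parameter". **Extended system.** An extended system of $\Sigma$ is a structured system $\hat\Sigma$: $\dot{\hat x}=\hat A\hat x+\hat Bu$, $\hat y=\hat C\hat x$, with orders $\hat n_i\ge 1$ ($i=1,\dots,n$), $\hat n=\sum_i\hat n_i$, $\hat x=(\hat x_1,\dots,\hat x_n)$, $\hat x_i\in\mathbb{R}^{\hat n_i}$. The diagonal blocks of $\hat A$ are $\hat a_i\in\mathbb{R}^{\hat n_i\times\hat n_i}$ and the off-diagonal blocks are $\hat a_{ij}\in\mathbb{R}^{\hat n_i\times\hat n_j}$; $\hat B$ has block rows $\hat b_i\in\mathbb{R}^{\hat n_i\times m}$ with columns $\hat b_{i,s}$; $\hat C=\mathrm{diag}(\hat c_1,\dots,\hat c_n)\in\mathbb{R}^{n\times\hat n}$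 with $\hat c_i\in\mathbb{R}^{1\times\hat n_i}$. Each entry of these matrices is free or fixed subject to the following. The entries of $\hat a_{ij}$ ($i\ne j$) may be free only if $a_{ij}\neq 0$, and are otherwise zero. The entries of $\hat b_{i,s}$ may be free only if $b_{i,s}\neq0$, and are otherwise zero. For each $i$, the entries of $\hat a_i$ are either all free (heterogeneous internal dynamics) or all fixed to zero (trivial internal dynamics). All entries of $\hat c_i$ are free if $\hat n_i>1$, and $\hat c_i=1$ if $\hat n_i=1$. The subsystems of $\hat\Sigma$ have homogeneous internal dynamics if $\hat a_i=0$ for all $i$. **Structural (output) controllability.** A structured system with state dimension $N$ and matrices $(A,B,C)$ is structurally controllable if for some choice of the free parameters $\mathcal R=[B\ AB\ \cdots\ A^{N-1}B]$ has full row rank, and structurally output controllable if for some choice of the free parameters (including those of $C$) $C\mathcal R$ has full row rank. **Graph.** To a structured system associate the directed graph whose nodes are the state nodes $x_1,\dots,x_N$ and the input nodes $u_1,\dots,u_m$, with an edge $(x_i,x_j)$ iff $A_{ji}\ne0$ and an edge $(u_i,x_j)$ iff $B_{ji}\neq0$. It is denoted $\mathrm G(\Sigma)$ for $\Sigma$. A stem is a sequence of distinct nodes $v_1,\dots,v_\ell$ with $(v_k,v_{k+1})$ an edge for all $k$, $v_1$ an input node and $v_\ell$ a state node. A cycle is a closed sequence $v_1,\dots,v_\ell=v_1$ with $(v_k,v_{k+1})$ an edge for all $k$ and $v_1,\dots,v_{\ell-1}$ distinct (self-loops included). A set of stems and cycles covers a set of nodes if each of these nodes lies on some member. The system is input-accessible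 if every state node is the end vertex of a stem. **Conditions on a set $\mathcal P$ of stems and cycles.** $\mathcal P$ contains: 1) a stem and a cycle sharing some node; 2) two (distinct) cycles sharing some node; 3) two stems sharing some node and originating from different input nodes; 4) two (distinct) stems originating from the same input node. **X-network.** An input-accessible network $\Sigma$ is an X-network if it is not structurally controllable and there exists a set of stems and cycles covering all state nodes of $\mathrm G(\Sigma)$ that satisfies (at least one of) conditions 1), 2), 3), but not 4). *)

theory Defs
  imports Complex_Main "Jordan_Normal_Form.DL_Rank" "Graph_Theory.Graph_Theory"
begin

section \<open>Structured systems\<close>

datatype entry = Fixed real | Free

text \<open>All matrices are indexed from 0. The nodes $x_1,\dots,x_N$ and $u_1,\dots,u_m$ become
  \<open>State 0, \<dots>, State (N - 1)\<close> and \<open>Input 0, \<dots>, Input (m - 1)\<close>.\<close>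

record structured_system =
  Amat :: "entry mat"
  Bmat :: "entry mat"
  Cmat :: "entry mat"

abbreviation state_dim :: "structured_system \<Rightarrow> nat" where
  "state_dim S \<equiv> dim_row (Amat S)"

abbreviation input_dim :: "structured_system \<Rightarrow> nat" where
  "input_dim S \<equiv> dim_col (Bmat S)"

definition realizations :: "entry mat \<Rightarrow> real mat set" where
  "realizations M = {R \<in> carrier_mat (dim_row M) (dim_col M).
     \<forall>i < dim_row M. \<forall>j < dim_col M. \<forall>c. M $$ (i, j) = Fixed c \<longrightarrow> R $$ (i, j) = c}"

definition original_network :: "structured_system \<Rightarrow> bool" where
  "original_network S \<longleftrightarrow> (let n = state_dim S; m = input_dim S in
     Amat S \<in> carrier_mat n n \<and>
     Bmat S \<in> carrier_mat n m \<and>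
     Cmat S = mat n n (\<lambda>(i, j). if i = j then Fixed 1 else Fixed 0) \<and>
     (\<forall>i < n. \<forall>j < n. Amat S $$ (i, j) \<in> {Fixed 0, Free}) \<and>
     (\<forall>i < n. Amat S $$ (i, i) = Fixed 0) \<and>
     (\<forall>i < n. \<forall>s < m. Bmat S $$ (i, s) \<in> {Fixed 0, Free}))"


section \<open>Structural controllability and structural output controllability\<close>

text \<open>The matrix $[B\ AB\ \cdots\ A^{N-1}B]$: with $m$ inputs, column $j$ is column
  \<open>j mod m\<close> of the block with exponent \<open>j div m\<close>.\<close>

definition controllability_matrix :: "real mat \<Rightarrow> real mat \<Rightarrow> real mat" where
  "controllability_matrix A B = (let N = dim_row A; m = dim_col B in
     mat N (N * m) (\<lambda>(i, j). (A ^\<^sub>m (j div m) * B) $$ (i, j mod m)))"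

definition full_row_rank :: "real mat \<Rightarrow> bool" where
  "full_row_rank M \<longleftrightarrow> vec_space.rank (dim_row M) M = dim_row M"

definition structurally_controllable :: "structured_system \<Rightarrow> bool" where
  "structurally_controllable S \<longleftrightarrow>
     (\<exists>A \<in> realizations (Amat S). \<exists>B \<in> realizations (Bmat S).
        full_row_rank (controllability_matrix A B))"

definition structurally_output_controllable :: "structured_system \<Rightarrow> bool" where
  "structurally_output_controllable S \<longleftrightarrow>
     (\<exists>A \<in> realizations (Amat S). \<exists>B \<in> realizations (Bmat S). \<exists>C \<in> realizations (Cmat S).
        full_row_rank (C * controllability_matrix A B))"


section \<open>The associated graph, stems and cycles\<close>

datatype node = State nat | Input nat

definition system_graph :: "structured_system \<Rightarrow> (node, node \<times> node) pre_digraph" where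
  "system_graph S = with_proj
     \<lparr> pverts = State ` {..<state_dim S} \<union> Input ` {..<input_dim S},
       parcs = {(State i, State j) | i j. i < state_dim S \<and> j < state_dim S \<and> Amat S $$ (j, i) = Free}
             \<union> {(Input s, State j) | s j. s < input_dim S \<and> j < state_dim S \<and> Bmat S $$ (j, s) = Free} \<rparr>"

definition stem :: "structured_system \<Rightarrow> node list \<Rightarrow> bool" where
  "stem S p \<longleftrightarrow> vpath p (system_graph S) \<and> hd p \<in> range Input \<and> last p \<in> range State"

definition cycle :: "structured_system \<Rightarrow> node list \<Rightarrow> bool" where
  "cycle S c \<longleftrightarrow> vwalk c (system_graph S) \<and> length c \<ge> 2 \<and> hd c = last c \<and> distinct (butlast c)"

text \<open>Closed sequences that differ only in the node at which they start are the same cycle.\<close>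

definition same_cycle :: "node list \<Rightarrow> node list \<Rightarrow> bool" where
  "same_cycle c d \<longleftrightarrow> (\<exists>k. butlast d = rotate k (butlast c))"

definition input_accessible :: "structured_system \<Rightarrow> bool" where
  "input_accessible S \<longleftrightarrow> (\<forall>i < state_dim S. \<exists>p. stem S p \<and> last p = State i)"

definition covers :: "node list set \<Rightarrow> node set \<Rightarrow> bool" where
  "covers P V \<longleftrightarrow> (\<forall>v \<in> V. \<exists>p \<in> P. v \<in> set p)"

definition stem_meets_cycle :: "structured_system \<Rightarrow> node list set \<Rightarrow> bool" where
  "stem_meets_cycle S P \<longleftrightarrow>
     (\<exists>p \<in> P. \<exists>c \<in> P. stem S p \<and> cycle S c \<and> set p \<inter> set c \<noteq> {})"

definition cycle_meets_cycle :: "structured_system \<Rightarrow> node list set \<Rightarrow> bool" where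
  "cycle_meets_cycle S P \<longleftrightarrow>
     (\<exists>c \<in> P. \<exists>d \<in> P. cycle S c \<and> cycle S d \<and> \<not> same_cycle c d \<and> set c \<inter> set d \<noteq> {})"

definition stem_meets_stem :: "structured_system \<Rightarrow> node list set \<Rightarrow> bool" where
  "stem_meets_stem S P \<longleftrightarrow>
     (\<exists>p \<in> P. \<exists>q \<in> P. stem S p \<and> stem S q \<and> hd p \<noteq> hd q \<and> set p \<inter> set q \<noteq> {})"

definition stems_from_same_input :: "structured_system \<Rightarrow> node list set \<Rightarrow> bool" where
  "stems_from_same_input S P \<longleftrightarrow>
     (\<exists>p \<in> P. \<exists>q \<in> P. stem S p \<and> stem S q \<and> p \<noteq> q \<and> hd p = hd q)"

definition X_network :: "structured_system \<Rightarrow> bool" where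
  "X_network S \<longleftrightarrow> original_network S \<and> input_accessible S \<and> \<not> structurally_controllable S \<and>
     (\<exists>P. (\<forall>p \<in> P. stem S p \<or> cycle S p) \<and>
          covers P (State ` {..<state_dim S}) \<and>
          (stem_meets_cycle S P \<or> cycle_meets_cycle S P \<or> stem_meets_stem S P) \<and>
          \<not> stems_from_same_input S P)"


section \<open>Extended systems\<close>

text \<open>For block sizes \<open>d 0, d 1, \<dots>\<close>, the global index of component \<open>k < d i\<close> of block \<open>i\<close>.\<close>

definition block_index :: "(nat \<Rightarrow> nat) \<Rightarrow> nat \<Rightarrow> nat \<Rightarrow> nat" where
  "block_index d i k = (\<Sum>j<i. d j) + k"

definition extended_system :: "structured_system \<Rightarrow> (nat \<Rightarrow> nat) \<Rightarrow> structured_system \<Rightarrow> bool" where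
  "extended_system S d E \<longleftrightarrow> (let n = state_dim S; m = input_dim S; N = (\<Sum>i<n. d i) in
     (\<forall>i < n. d i \<ge> 1) \<and>
     Amat E \<in> carrier_mat N N \<and>
     Bmat E \<in> carrier_mat N m \<and>
     Cmat E \<in> carrier_mat n N \<and>
     (\<forall>i < n. \<forall>j < n. i \<noteq> j \<longrightarrow> (\<forall>k < d i. \<forall>l < d j.
        Amat E $$ (block_index d i k, block_index d j l) \<in>
          (if Amat S $$ (i, j) = Free then {Fixed 0, Free} else {Fixed 0}))) \<and>
     (\<forall>i < n. \<forall>s < m. \<forall>k < d i.
        Bmat E $$ (block_index d i k, s) \<in>
          (if Bmat S $$ (i, s) = Free then {Fixed 0, Free} else {Fixed 0})) \<and>
     (\<forall>i < n.
        (\<forall>k < d i. \<forall>l < d i. Amat E $$ (block_index d i k, block_index d i l) = Free) \<or>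
        (\<forall>k < d i. \<forall>l < d i. Amat E $$ (block_index d i k, block_index d i l) = Fixed 0)) \<and>
     (\<forall>i < n. \<forall>j < n. \<forall>l < d j.
        Cmat E $$ (i, block_index d j l) =
          (if i \<noteq> j then Fixed 0 else if d j > 1 then Free else Fixed 1)))"

definition homogeneous_internal_dynamics ::
  "structured_system \<Rightarrow> (nat \<Rightarrow> nat) \<Rightarrow> structured_system \<Rightarrow> bool" where
  "homogeneous_internal_dynamics S d E \<longleftrightarrow>
     (\<forall>i < state_dim S. \<forall>k < d i. \<forall>l < d i.
        Amat E $$ (block_index d i k, block_index d i l) = Fixed 0)"

end

theory Submission
  imports Defs "HOL-Computational_Algebra.Fundamental_Theorem_Algebra"
begin

text \<open>Pick finitely many members of the given set of stems and cycles that still cover all states,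
  and split every state into one copy for each chosen member through it. In the extended graph
  the members become pairwise disjoint, and distinct stems start at distinct inputs. Realise the
  stem edges with weight 1 and the edges of the cycles with positive weights that are constant on
  each cycle and differ between cycles. Input accessibility provides one further edge into every
  cycle, from an input or from a state strictly closer to the inputs, so stems and cycles form a forest
  rooted at the inputs.

  By Hautus' criterion it remains to exclude a left eigenvector \<open>v\<close> of \<open>A\<close> with eigenvalue \<open>\<mu>\<close>
  annihilating \<open>B\<close>. A cycle of weight \<open>c\<close> all of whose children carry \<open>v = 0\<close> forces \<open>\<bar>\<mu>\<bar> = c\<close>
  if \<open>v\<close> is not zero on it. Hence for \<open>\<mu> \<noteq> 0\<close> the support of \<open>v\<close> lies on a single branch of the
  forest, on which \<open>v\<close> vanishes nowhere, and the equation at the parent of its topmost element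
  fails; for \<open>\<mu> = 0\<close> the support contains no cycle, and the same equation applies to stems.
  Output controllability follows because \<open>C\<close> has a realisation of full row rank.\<close>


section \<open>Rank and the Hautus criterion\<close>

text \<open>Zero rows pad the \<open>r\<close> vectors to a square matrix. As \<open>r < n\<close>,
  its row \<open>r\<close> is zero, so the matrix is singular and has a nonzero kernel
  vector.\<close>

lemma exists_nonzero_orthogonal:
  fixes w :: "nat \<Rightarrow> 'a :: field vec"
  assumes r: "r < n" and w: "\<And>i. i < r \<Longrightarrow> w i \<in> carrier_vec n"
  shows "\<exists>u \<in> carrier_vec n. u \<noteq> 0\<^sub>v n \<and> (\<forall>i<r. w i \<bullet> u = 0)"
proof -
  define M where "M = mat n n (\<lambda>(i, j). if i < r then w i $ j else 0)"
  have M: "M \<in> carrier_mat n n"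
    by (simp add: M_def)
  have "M\<^sup>T *\<^sub>v unit_vec n r = 0\<^sub>v n"
    using r by (intro eq_vecI) (auto simp: M_def)
  moreover have "unit_vec n r \<noteq> (0\<^sub>v n :: 'a vec)"
    using r by (metis index_unit_vec(2) index_zero_vec(1) zero_neq_one)
  ultimately have "det (M\<^sup>T) = 0"
    using det_0_iff_vec_prod_zero_field[of "M\<^sup>T" n] M unit_vec_carrier[of n r]
      transpose_carrier_mat[of M n n] by blast
  then have "det M = 0"
    using det_transpose[OF M] by simp
  then obtain u where u: "u \<in> carrier_vec n" "u \<noteq> 0\<^sub>v n" "M *\<^sub>v u = 0\<^sub>v n"
    using det_0_iff_vec_prod_zero_field[OF M] by blast
  have "w i \<bullet> u = 0" if i: "i < r" for i
  proof -
    have "row M i = w i"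
      using i r w[OF i] by (auto simp: M_def)
    then have "w i \<bullet> u = (M *\<^sub>v u) $ i"
      using i r M by simp
    then show ?thesis
      using i r u(3) by simp
  qed
  then show ?thesis
    using u by blast
qed

text \<open>Otherwise a maximal independent set \<open>U\<close> of columns has fewer than
  \<open>n\<close> elements, so some \<open>u \<noteq> 0\<close> is orthogonal to \<open>U\<close>.
  By maximality every column lies in the span of \<open>U\<close>, so \<open>u\<close> is orthogonal
  to all of them.\<close>

lemma (in vec_space) rank_eq_dimI:
  assumes A: "A \<in> carrier_mat n nc"
    and ker: "\<And>u. u \<in> carrier_vec n \<Longrightarrow> (\<And>x. x \<in> set (cols A) \<Longrightarrow> x \<bullet> u = 0) \<Longrightarrow> u = 0\<^sub>v n"
  shows "rank A = n"
proof (rule ccontr)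
  let ?P = "\<lambda>T. T \<subseteq> set (cols A) \<and> lin_indpt T"
  assume ne: "rank A \<noteq> n"
  have cols: "set (cols A) \<subseteq> carrier_vec n"
    using cols_dim A by blast
  have "lin_indpt {}"
    by (simp add: lin_dep_def)
  then obtain U where U: "finite U" "maximal U ?P"
    using maximal_exists_superset[of "set (cols A)" ?P "{}"] by auto
  then have U_sub: "U \<subseteq> set (cols A)" and U_li: "lin_indpt U"
    by (auto simp: maximal_def)
  have Uc: "U \<subseteq> carrier_vec n"
    using U_sub cols by blast
  have "card U \<le> n"
    using li_le_dim(2)[OF fin_dim _ U_li] Uc dim_is_n by simp
  moreover have "rank A = card U"
    by (rule rank_card_indpt[OF A U(2)])
  ultimately have lt: "card U < n"
    using ne by simp
  obtain us where us: "set us = U" "distinct us"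
    using finite_distinct_list[OF U(1)] by blast
  have len: "length us < n"
    using lt us distinct_card by metis
  have nth: "us ! i \<in> carrier_vec n" if "i < length us" for i
    using that us Uc nth_mem by blast
  obtain u where u: "u \<in> carrier_vec n" "u \<noteq> 0\<^sub>v n" "\<forall>i<length us. us ! i \<bullet> u = 0"
    using exists_nonzero_orthogonal[OF len, of "\<lambda>i. us ! i"] nth by blast
  let ?T = "{x \<in> carrier_vec n. x \<bullet> u = 0}"
  have "U \<subseteq> ?T"
    using u(3) us(1) Uc by (auto simp: in_set_conv_nth)
  moreover have "submodule class_ring ?T V"
    using u(1) by (unfold_locales) (auto simp: add_scalar_prod_distrib[of _ n] class_ring_simps module_vec_simps)
  ultimately have sp: "span U \<subseteq> ?T"
    by (intro span_is_subset)
  have "x \<bullet> u = 0" if x: "x \<in> set (cols A)" for x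
  proof (rule ccontr)
    assume "x \<bullet> u \<noteq> 0"
    then have "x \<notin> span U"
      using sp by blast
    then have "lin_indpt (insert x U)"
      using lin_dep_iff_in_span[of U x] Uc U_li x cols span_mem[of U x]
      by (metis (no_types, lifting) cV in_own_span insert_is_Un subset_eq Un_commute)
    then have "insert x U = U"
      using U(2) x U_sub unfolding maximal_def by blast
    then have "x \<in> U" by blast
    then show False
      using \<open>x \<notin> span U\<close> in_own_span[of U] Uc by auto
  qed
  then show False
    using ker u by blast
qed

lemma full_row_rankI:
  assumes "\<And>u. u \<in> carrier_vec (dim_row M) \<Longrightarrow> M\<^sup>T *\<^sub>v u = 0\<^sub>v (dim_col M) \<Longrightarrow> u = 0\<^sub>v (dim_row M)"
  shows "full_row_rank M"
  unfolding full_row_rank_def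
proof (rule vec_space.rank_eq_dimI)
  show "M \<in> carrier_mat (dim_row M) (dim_col M)" by simp
  fix u assume u: "u \<in> carrier_vec (dim_row M)" "\<And>x. x \<in> set (cols M) \<Longrightarrow> x \<bullet> u = 0"
  have "M\<^sup>T *\<^sub>v u = 0\<^sub>v (dim_col M)"
    by (rule eq_vecI) (auto intro!: u(2) simp: cols_def)
  then show "u = 0\<^sub>v (dim_row M)"
    using assms u(1) by blast
qed

section \<open>Krylov vectors and left eigenvectors\<close>

text \<open>With \<open>w k x\<close> as coordinate \<open>x\<close> of the \<open>k\<close>-th
  vector, a dependence among \<open>N + 1\<close> vectors is a nonzero vector of length
  \<open>Suc N\<close> orthogonal to the \<open>N\<close> coordinate rows.\<close>

lemma exists_linear_dependence:
  fixes w :: "nat \<Rightarrow> nat \<Rightarrow> 'a :: field"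
  obtains a where "\<exists>k\<le>N. a k \<noteq> 0" "\<And>x. x < N \<Longrightarrow> (\<Sum>k\<le>N. a k * w k x) = 0"
proof -
  obtain v where v: "v \<in> carrier_vec (Suc N)" "v \<noteq> 0\<^sub>v (Suc N)"
    "\<forall>x<N. vec (Suc N) (\<lambda>k. w k x) \<bullet> v = 0"
    using exists_nonzero_orthogonal[of N "Suc N" "\<lambda>x. vec (Suc N) (\<lambda>k. w k x)"] by auto
  show thesis
  proof (rule that[of "\<lambda>k. v $ k"])
    show "\<exists>k\<le>N. v $ k \<noteq> 0"
    proof (rule ccontr)
      assume "\<not> ?thesis"
      then have "v = 0\<^sub>v (Suc N)"
        using v(1) by (intro eq_vecI) auto
      then show False using v(2) by blast
    qed
    fix x assume x: "x < N"
    have "0 = vec (Suc N) (\<lambda>k. w k x) \<bullet> v"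
      using v(3) x by simp
    also have "\<dots> = (\<Sum>k\<in>{0..<Suc N}. w k x * v $ k)"
      using v(1) by (simp add: scalar_prod_def del: sum.op_ivl_Suc)
    also have "\<dots> = (\<Sum>k\<le>N. v $ k * w k x)"
      by (intro sum.cong) (auto simp: mult.commute)
    finally show "(\<Sum>k\<le>N. v $ k * w k x) = 0" by simp
  qed
qed

text \<open>The Popov-Belevitch-Hautus test for left eigenvectors, over the complex numbers because
  a real \<open>A\<close> need not have real eigenvalues.\<close>

definition Hautus_condition :: "real mat \<Rightarrow> real mat \<Rightarrow> bool" where
  "Hautus_condition A B \<longleftrightarrow> (\<forall>v \<mu>.
     (\<forall>x<dim_row A. (\<Sum>y<dim_row A. v y * complex_of_real (A $$ (y, x))) = \<mu> * v x) \<and>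
     (\<forall>s<dim_col B. (\<Sum>y<dim_row A. v y * complex_of_real (B $$ (y, s))) = 0) \<longrightarrow>
     (\<forall>x<dim_row A. v x = 0))"

text \<open>A nonzero \<open>u\<close> in the left kernel yields rows u^T A^k that annihilate
  \<open>B\<close> for \<open>k < N\<close>. A suitable polynomial combination of them is a left
  eigenvector of \<open>A\<close> that still annihilates \<open>B\<close>.\<close>

lemma Hautus_left_kernel:
  fixes A B :: "real mat"
  assumes A: "A \<in> carrier_mat N N" and B: "B \<in> carrier_mat N m"
    and eig: "Hautus_condition A B"
    and u: "u \<in> carrier_vec N"
    and ker: "(controllability_matrix A B)\<^sup>T *\<^sub>v u = 0\<^sub>v (N * m)"
  shows "u = 0\<^sub>v N"
proof (rule ccontr)
  assume u_ne: "u \<noteq> 0\<^sub>v N"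
  \<comment> \<open>\<open>w k\<close> is the row u^T A^k, embedded in the complex numbers so that
    nonconstant annihilating polynomials have roots.\<close>
  define w where "w k x = complex_of_real (\<Sum>y<N. u $ y * (A ^\<^sub>m k) $$ (y, x))" for k x
  have Ak: "A ^\<^sub>m k \<in> carrier_mat N N" for k
    using A by simp
  have w_0: "w 0 x = u $ x" if "x < N" for x
  proof -
    have "(\<Sum>y<N. u $ y * (1\<^sub>m N) $$ (y, x)) = (\<Sum>y<N. if y = x then u $ y else 0)"
      using that by (intro sum.cong) auto
    then show ?thesis
      using that A by (simp add: w_def)
  qed
  have w_Suc: "w (Suc k) x = (\<Sum>y<N. w k y * A $$ (y, x))" if x: "x < N" for k x
  proof -
    have "(A ^\<^sub>m Suc k) $$ (y, x) = (\<Sum>z<N. (A ^\<^sub>m k) $$ (y, z) * A $$ (z, x))" if "y < N" for y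
      using that x A Ak[of k] by (simp add: scalar_prod_def atLeast0LessThan)
    then have "(\<Sum>y<N. u $ y * (A ^\<^sub>m Suc k) $$ (y, x))
        = (\<Sum>y<N. \<Sum>z<N. u $ y * ((A ^\<^sub>m k) $$ (y, z) * A $$ (z, x)))"
      by (simp add: sum_distrib_left)
    also have "\<dots> = (\<Sum>z<N. \<Sum>y<N. u $ y * ((A ^\<^sub>m k) $$ (y, z) * A $$ (z, x)))"
      by (rule sum.swap)
    also have "\<dots> = (\<Sum>z<N. (\<Sum>y<N. u $ y * (A ^\<^sub>m k) $$ (y, z)) * A $$ (z, x))"
      by (simp add: sum_distrib_right mult.assoc)
    finally show ?thesis
      by (simp add: w_def)
  qed
  have w_B: "(\<Sum>y<N. w k y * B $$ (y, s)) = 0" if k: "k < N" and s: "s < m" for k s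
  proof -
    \<comment> \<open>This column of the controllability matrix is column \<open>s\<close> of A^k
      B.\<close>
    let ?j = "k * m + s"
    have "k * m + s < Suc k * m" using s by simp
    also have "Suc k * m \<le> N * m" using k by (intro mult_right_mono) auto
    finally have j: "?j < N * m" .
    have jdm: "?j div m = k" "?j mod m = s"
      using s by auto
    have "0 = ((controllability_matrix A B)\<^sup>T *\<^sub>v u) $ ?j"
      using ker j by simp
    also have "\<dots> = (\<Sum>y<N. (A ^\<^sub>m k * B) $$ (y, s) * u $ y)"
      using j A B u jdm
      by (simp add: controllability_matrix_def Let_def scalar_prod_def atLeast0LessThan)
    also have "\<dots> = (\<Sum>y<N. \<Sum>z<N. (A ^\<^sub>m k) $$ (y, z) * B $$ (z, s) * u $ y)"
      using A B Ak[of k] s by (simp add: scalar_prod_def atLeast0LessThan sum_distrib_right)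
    also have "\<dots> = (\<Sum>z<N. \<Sum>y<N. (A ^\<^sub>m k) $$ (y, z) * B $$ (z, s) * u $ y)"
      by (rule sum.swap)
    also have "\<dots> = (\<Sum>z<N. (\<Sum>y<N. u $ y * (A ^\<^sub>m k) $$ (y, z)) * B $$ (z, s))"
      by (simp add: sum_distrib_left mult_ac)
    finally have "complex_of_real (\<Sum>z<N. (\<Sum>y<N. u $ y * (A ^\<^sub>m k) $$ (y, z)) * B $$ (z, s)) = 0"
      by simp
    then show ?thesis
      by (simp add: w_def)
  qed
  \<comment> \<open>\<open>ev p\<close> is the row vector \<open>u\<^sup>T p(A)\<close>; an annihilating \<open>p\<close> of minimal degree yields an
    eigenvector after splitting off a linear factor.\<close>
  define ev where "ev p x = (\<Sum>k\<le>N. coeff p k * w k x)" for p x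
  define ann where "ann p \<longleftrightarrow> p \<noteq> 0 \<and> degree p \<le> N \<and> (\<forall>x<N. ev p x = 0)" for p
  obtain a where a: "\<exists>k\<le>N. a k \<noteq> 0" "\<And>x. x < N \<Longrightarrow> (\<Sum>k\<le>N. a k * w k x) = 0"
    using exists_linear_dependence[of N w] by metis
  have "ann (\<Sum>k\<le>N. monom (a k) k)"
  proof -
    let ?p = "\<Sum>k\<le>N. monom (a k) k"
    have co: "coeff ?p k = (if k \<le> N then a k else 0)" for k
      by (simp add: coeff_sum)
    have "?p \<noteq> 0"
      using a(1) co by (metis coeff_0)
    moreover have "degree ?p \<le> N"
      by (intro degree_le) (simp add: co)
    ultimately show ?thesis
      using a(2) by (simp add: ann_def ev_def co)
  qed
  then obtain p where p: "ann p" "\<And>q. ann q \<Longrightarrow> degree p \<le> degree q"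
    using ex_has_least_nat[of ann _ degree] by metis
  have "degree p \<noteq> 0"
  proof
    assume "degree p = 0"
    then obtain c where c: "p = [:c:]"
      using degree_eq_zeroE by blast
    have "c \<noteq> 0"
      using p(1) c by (auto simp: ann_def)
    have "u $ x = 0" if "x < N" for x
    proof -
      have "ev p x = (\<Sum>k\<le>N. if k = 0 then c * w 0 x else 0)"
        unfolding ev_def c by (intro sum.cong) (auto simp: coeff_pCons split: nat.splits)
      also have "\<dots> = c * w 0 x" by simp
      finally show ?thesis
        using p(1) that \<open>c \<noteq> 0\<close> w_0[OF that] by (simp add: ann_def)
    qed
    then show False
      using u u_ne by (metis eq_vecI carrier_vecD index_zero_vec(1,2))
  qed
  then have "\<not> constant (poly p)"
    by (simp add: constant_degree)
  then obtain \<mu> where "poly p \<mu> = 0"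
    using fundamental_theorem_of_algebra by blast
  then obtain q where q: "p = [:-\<mu>, 1:] * q"
    using poly_eq_0_iff_dvd by (metis dvdE)
  have q_ne: "q \<noteq> 0"
    using p(1) q by (auto simp: ann_def)
  then have deg: "degree p = Suc (degree q)"
    unfolding q by (subst degree_mult_eq) auto
  \<comment> \<open>Degree below \<open>N\<close> keeps \<open>ev q\<close> within the powers
    \<open>k < N\<close>, the range covered by \<open>w_B\<close>.\<close>
  then have deg_q: "degree q < N"
    using p(1) by (simp add: ann_def)
  then have q_N: "coeff q N = 0"
    by (simp add: coeff_eq_0)
  have "\<not> ann q"
    using p(2)[of q] deg by auto
  then obtain x0 where x0: "x0 < N" "ev q x0 \<noteq> 0"
    using q_ne deg_q by (auto simp: ann_def)
  have ev_lt: "ev q x = (\<Sum>k<N. coeff q k * w k x)" for x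
    unfolding ev_def using q_N by (simp add: lessThan_Suc_atMost[symmetric])
  have ev_A: "(\<Sum>y<N. ev q y * A $$ (y, x)) = \<mu> * ev q x" if x: "x < N" for x
  proof -
    obtain N' where N': "N = Suc N'"
      using x by (cases N) auto
    have "(\<Sum>y<N. ev q y * A $$ (y, x)) = (\<Sum>y<N. \<Sum>k<N. coeff q k * w k y * A $$ (y, x))"
      by (simp add: ev_lt sum_distrib_right)
    also have "\<dots> = (\<Sum>k<N. \<Sum>y<N. coeff q k * w k y * A $$ (y, x))"
      by (rule sum.swap)
    also have "\<dots> = (\<Sum>k<N. coeff q k * w (Suc k) x)"
      by (simp add: w_Suc[OF x] sum_distrib_left mult.assoc)
    finally have shift: "(\<Sum>y<N. ev q y * A $$ (y, x)) = (\<Sum>k<N. coeff q k * w (Suc k) x)" .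
    \<comment> \<open>Multiplication by \<open>A\<close> shifts the coefficients of
      \<open>q\<close>. As p = (X - \<open>\<mu>\<close>) q, the equation u^T p(A) = 0 says that
      \<open>ev q\<close> is a left eigenvector for \<open>\<mu>\<close>.\<close>
    have pq: "p = pCons 0 q - smult \<mu> q"
      unfolding q by simp
    have "0 = ev p x"
      using p(1) x by (simp add: ann_def)
    also have "\<dots> = (\<Sum>k\<le>N. coeff (pCons 0 q) k * w k x) - \<mu> * ev q x"
      unfolding pq ev_def by (simp add: left_diff_distrib sum_subtractf sum_distrib_left mult.assoc)
    also have "(\<Sum>k\<le>N. coeff (pCons 0 q) k * w k x) = (\<Sum>k<N. coeff q k * w (Suc k) x)"
      unfolding lessThan_Suc_atMost[symmetric] sum.lessThan_Suc_shift by simp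
    finally show ?thesis
      using shift by simp
  qed
  have ev_B: "(\<Sum>y<N. ev q y * B $$ (y, s)) = 0" if s: "s < m" for s
  proof -
    have "(\<Sum>y<N. ev q y * B $$ (y, s)) = (\<Sum>y<N. \<Sum>k<N. coeff q k * w k y * B $$ (y, s))"
      by (simp add: ev_lt sum_distrib_right)
    also have "\<dots> = (\<Sum>k<N. \<Sum>y<N. coeff q k * w k y * B $$ (y, s))"
      by (rule sum.swap)
    also have "\<dots> = (\<Sum>k<N. coeff q k * (\<Sum>y<N. w k y * B $$ (y, s)))"
      by (simp add: sum_distrib_left mult.assoc)
    also have "\<dots> = 0"
      using w_B s by simp
    finally show ?thesis .
  qed
  have dims: "dim_row A = N" "dim_col B = m"
    using A B by auto
  show False
    using eig[unfolded Hautus_condition_def dims, rule_format, of "ev q" \<mu> x0] ev_A ev_B x0 by blast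
qed

section \<open>Forests of cells\<close>

text \<open>A cell is an orbit of \<open>nx\<close>: a cycle all of whose edges have weight \<open>c > 0\<close>, or a single stem
  state if \<open>c = 0\<close>. The edge entering the cell \<open>r\<close> leads from \<open>par r\<close>, an input or a node of another
  cell, to \<open>ent r\<close>.\<close>

locale cell_forest =
  fixes X :: "'a set" and R :: "'r set" and cell :: "'a \<Rightarrow> 'r" and nx :: "'a \<Rightarrow> 'a"
    and c :: "'r \<Rightarrow> real" and ent :: "'r \<Rightarrow> 'a" and par :: "'r \<Rightarrow> 'i + 'a" and rk :: "'r \<Rightarrow> nat"
  assumes fin_X: "finite X" and fin_R: "finite R"
    and cell_in: "x \<in> X \<Longrightarrow> cell x \<in> R"
    and nx_in: "x \<in> X \<Longrightarrow> nx x \<in> X"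
    and cell_nx: "x \<in> X \<Longrightarrow> cell (nx x) = cell x"
    and nx_transitive: "x \<in> X \<Longrightarrow> y \<in> X \<Longrightarrow> cell x = cell y \<Longrightarrow> \<exists>k. y = (nx ^^ k) x"
    and ent_in: "r \<in> R \<Longrightarrow> ent r \<in> X" and cell_ent: "r \<in> R \<Longrightarrow> cell (ent r) = r"
    and par_in: "r \<in> R \<Longrightarrow> par r = Inr x \<Longrightarrow> x \<in> X"
    and par_rk: "r \<in> R \<Longrightarrow> par r = Inr x \<Longrightarrow> rk (cell x) < rk r"
    and c_nonneg: "r \<in> R \<Longrightarrow> 0 \<le> c r"
    and c_inj: "r \<in> R \<Longrightarrow> r' \<in> R \<Longrightarrow> c r = c r' \<Longrightarrow> 0 < c r \<Longrightarrow> r = r'"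
    and acyclic_singleton: "x \<in> X \<Longrightarrow> y \<in> X \<Longrightarrow> cell x = cell y \<Longrightarrow> c (cell x) = 0 \<Longrightarrow> x = y"
    and acyclic_par: "r \<in> R \<Longrightarrow> c r = 0 \<Longrightarrow> par r = Inr x \<Longrightarrow> c (cell x) = 0"
    and acyclic_par_inj: "r \<in> R \<Longrightarrow> r' \<in> R \<Longrightarrow> c r = 0 \<Longrightarrow> c r' = 0 \<Longrightarrow> par r = par r' \<Longrightarrow> r = r'"
begin

section \<open>Orbits of the successor map\<close>

text \<open>Walking on from \<open>nx x\<close> until \<open>x\<close> is reached gives a preimage
  of \<open>x\<close>; on a finite set surjectivity implies bijectivity.\<close>

lemma nx_bij: "bij_betw nx X X"
proof -
  have "X \<subseteq> nx ` X"
  proof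
    fix x assume x: "x \<in> X"
    then obtain k where "x = (nx ^^ k) (nx x)"
      using nx_transitive[of "nx x" x] by (auto simp: nx_in cell_nx)
    then have "x = nx ((nx ^^ k) x)"
      by (simp add: funpow_swap1)
    moreover have "(nx ^^ k) x \<in> X"
      using x by (induction k) (auto intro: nx_in)
    ultimately show "x \<in> nx ` X" by blast
  qed
  then have "nx ` X = X"
    using nx_in by blast
  then show ?thesis
    using eq_card_imp_inj_on[OF fin_X, of nx] by (simp add: bij_betw_def)
qed

lemma nx_pow_in: "x \<in> X \<Longrightarrow> (nx ^^ k) x \<in> X"
  by (induction k) (auto intro: nx_in)

lemma cell_nx_pow: "x \<in> X \<Longrightarrow> cell ((nx ^^ k) x) = cell x"
  by (induction k) (auto simp: cell_nx nx_pow_in)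

text \<open>No step is assumed along the edge from \<open>b\<close> to its successor: the remaining edges of the cycle still
  connect the whole cell.\<close>

lemma cell_propagate:
  assumes step: "\<And>x. x \<in> X \<Longrightarrow> cell x = r \<Longrightarrow> x \<noteq> b \<Longrightarrow> Q x \<longleftrightarrow> Q (nx x)"
    and xy: "x \<in> X" "y \<in> X" "cell x = r" "cell y = r" and b: "b \<in> X" "cell b = r"
  shows "Q x \<longleftrightarrow> Q y"
proof -
  let ?z = "nx b"
  have z: "?z \<in> X" "cell ?z = r"
    using b by (simp_all add: nx_in cell_nx)
  have "Q y \<longleftrightarrow> Q ?z" if y: "y \<in> X" "cell y = r" for y
  proof -
    have ex: "\<exists>k. y = (nx ^^ k) ?z"
      using nx_transitive[of ?z y] y z by simp
    define k where "k = (LEAST k. y = (nx ^^ k) ?z)"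
    have k: "y = (nx ^^ k) ?z"
      unfolding k_def by (rule LeastI_ex[OF ex])
    have kmin: "k \<le> l" if "y = (nx ^^ l) ?z" for l
      unfolding k_def using that by (rule Least_le)
    \<comment> \<open>Passing \<open>b\<close> before reaching \<open>y\<close> would return to
      \<open>?z\<close> and leave a walk shorter than the least \<open>k\<close>.\<close>
    have not_b: "(nx ^^ j) ?z \<noteq> b" if "j < k" for j
    proof
      assume j: "(nx ^^ j) ?z = b"
      have "y = (nx ^^ ((k - Suc j) + Suc j)) ?z"
        using k that by simp
      also have "\<dots> = (nx ^^ (k - Suc j)) ((nx ^^ Suc j) ?z)"
        by (simp only: funpow_add o_apply)
      also have "(nx ^^ Suc j) ?z = ?z"
        using j by simp
      finally show False
        using kmin[of "k - Suc j"] that by simp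
    qed
    have "Q ((nx ^^ j) ?z) \<longleftrightarrow> Q ?z" if "j \<le> k" for j
      using that
    proof (induction j)
      case (Suc j)
      have "Q ((nx ^^ j) ?z) \<longleftrightarrow> Q (nx ((nx ^^ j) ?z))"
        using Suc.prems z not_b[of j] by (intro step) (auto simp: nx_pow_in cell_nx_pow)
      then show ?case using Suc by simp
    qed simp
    then show ?thesis
      using k by blast
  qed
  then show ?thesis
    using xy by blast
qed

section \<open>Vanishing of eigenvectors on a forest\<close>

text \<open>\<open>node\<close> is the left eigenvector equation at \<open>x\<close>, whose
  out-edges lead to \<open>nx x\<close> with weight \<open>c (cell x)\<close> and with weight 1 to
  the entries of the cells hanging from \<open>x\<close>; \<open>input\<close> says that
  \<open>v\<close> annihilates \<open>B\<close>.\<close>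

lemma eigenvector_zero:
  fixes v :: "'a \<Rightarrow> complex" and \<mu> :: complex
  assumes node: "\<And>x. x \<in> X \<Longrightarrow>
      \<mu> * v x = c (cell x) * v (nx x) + (\<Sum>r\<in>{r \<in> R. par r = Inr x}. v (ent r))"
    and input: "\<And>s. (\<Sum>r\<in>{r \<in> R. par r = Inl s}. v (ent r)) = 0"
    and x: "x \<in> X"
  shows "v x = 0"
proof (rule ccontr)
  assume x_ne: "v x \<noteq> 0"
  \<comment> \<open>\<open>Z\<close> is the support of \<open>v\<close> in terms of cells,
    \<open>Ch\<close> the parent-child relation between cells.\<close>
  define Z where "Z = {r \<in> R. \<exists>x\<in>X. cell x = r \<and> v x \<noteq> 0}"
  define Ch where "Ch = {(r, r'). r' \<in> R \<and> (\<exists>x. par r' = Inr x \<and> cell x = r)}"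
  have Z_R: "Z \<subseteq> R" and fin_Z: "finite Z"
    using fin_R by (auto simp: Z_def)
  have Z_ne: "cell x \<in> Z"
    using x x_ne by (auto simp: Z_def cell_in)
  have not_Z: "v y = 0" if "y \<in> X" "cell y \<notin> Z" for y
    using that by (auto simp: Z_def cell_in)
  have ent_Z: "v (ent r) = 0" if "r \<in> R" "r \<notin> Z" for r
    using that by (auto intro!: not_Z simp: ent_in cell_ent)
  have Ch_rk: "rk r < rk r'" if "(r, r') \<in> Ch" for r r'
    using that par_rk by (auto simp: Ch_def)
  have Ch_rtrancl_rk: "rk r \<le> rk r'" if "(r, r') \<in> Ch\<^sup>*" for r r'
    using that by (induction rule: rtrancl_induct) (auto dest!: Ch_rk)
  have children: "(\<Sum>r\<in>{r \<in> R. par r = Inr y}. v (ent r)) = 0"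
    if "\<And>r'. r' \<in> Z \<Longrightarrow> (cell y, r') \<notin> Ch" for y
    using that by (intro sum.neutral) (auto simp: Ch_def intro: ent_Z)
  \<comment> \<open>Without supported children the equation is
    \<open>\<mu> * v y = c r * v (nx y)\<close> on the whole cell. Moduli are summed over the cell,
    which \<open>nx\<close> permutes, and the positive common sum cancels.\<close>
  have leaf: "cmod \<mu> = c r" if r: "r \<in> Z" and ch: "\<And>r'. r' \<in> Z \<Longrightarrow> (r, r') \<notin> Ch" for r
  proof -
    let ?C = "{y \<in> X. cell y = r}"
    have fin_C: "finite ?C"
      using fin_X by simp
    have nx_C: "nx ` ?C = ?C"
    proof (rule card_subset_eq[OF fin_C])
      show "nx ` ?C \<subseteq> ?C"
        by (auto simp: nx_in cell_nx)
      show "card (nx ` ?C) = card ?C"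
        using nx_bij by (intro card_image) (auto simp: bij_betw_def inj_on_def)
    qed
    have inj: "inj_on nx ?C"
      using nx_bij by (auto simp: bij_betw_def inj_on_def)
    have eq: "cmod \<mu> * cmod (v y) = c r * cmod (v (nx y))" if "y \<in> ?C" for y
    proof -
      have "\<mu> * v y = c r * v (nx y)"
        using that node[of y] children[of y] ch by auto
      then have "cmod (\<mu> * v y) = cmod (c r * v (nx y))"
        by simp
      then show ?thesis
        using c_nonneg r Z_R by (auto simp: norm_mult)
    qed
    have "cmod \<mu> * (\<Sum>y\<in>?C. cmod (v y)) = (\<Sum>y\<in>?C. c r * cmod (v (nx y)))"
      unfolding sum_distrib_left by (intro sum.cong refl eq)
    also have "\<dots> = c r * (\<Sum>y\<in>?C. cmod (v (nx y)))"
      by (simp add: sum_distrib_left)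
    also have "(\<Sum>y\<in>?C. cmod (v (nx y))) = (\<Sum>y\<in>nx ` ?C. cmod (v y))"
      using sum.reindex[OF inj, of "\<lambda>y. cmod (v y)"] by simp
    finally have "cmod \<mu> * (\<Sum>y\<in>?C. cmod (v y)) = c r * (\<Sum>y\<in>?C. cmod (v y))"
      by (simp only: nx_C)
    moreover obtain y where "y \<in> ?C" "v y \<noteq> 0"
      using r by (auto simp: Z_def)
    then have "(\<Sum>y\<in>?C. cmod (v y)) > 0"
      using fin_C by (intro sum_pos2[of _ y]) auto
    ultimately show ?thesis
      by simp
  qed
  show False
  proof (cases "\<mu> = 0")
    case True
    \<comment> \<open>Take a supported cycle of largest rank. No stem cell hangs from a cycle, so a
      supported child would be a cycle of larger rank. Hence the cycle is a leaf, and
      \<open>\<mu> = 0\<close> forces its weight to be 0.\<close>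
    have acyclic: "c r = 0" if r: "r \<in> Z" for r
    proof (rule ccontr)
      assume "c r \<noteq> 0"
      then have ne: "r \<in> Z \<and> c r \<noteq> 0"
        using r by blast
      have "\<forall>q. q \<in> Z \<and> c q \<noteq> 0 \<longrightarrow> rk q < Suc (Max (rk ` Z))"
        using fin_Z by (auto simp: less_Suc_eq_le)
      with ne obtain q where q: "q \<in> Z" "c q \<noteq> 0"
        and qmax: "\<And>q'. q' \<in> Z \<Longrightarrow> c q' \<noteq> 0 \<Longrightarrow> rk q' \<le> rk q"
        using ex_has_greatest_nat[of "\<lambda>r. r \<in> Z \<and> c r \<noteq> 0" r rk "Suc (Max (rk ` Z))"] by blast
      have "(q, q') \<notin> Ch" if "q' \<in> Z" for q'
      proof
        assume ch: "(q, q') \<in> Ch"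
        then have "c q' \<noteq> 0"
          using acyclic_par q(2) by (auto simp: Ch_def)
        then show False
          using qmax[OF that] Ch_rk[OF ch] by simp
      qed
      then show False
        using leaf[OF q(1)] q(2) True by simp
    qed
    let ?r = "cell x"
    have r: "?r \<in> R" "?r \<in> Z" "c ?r = 0"
      using Z_ne Z_R acyclic by auto
    have "x = ent ?r"
      using acyclic_singleton[of x "ent ?r"] x r by (simp add: ent_in cell_ent)
    then have v_ent: "v (ent ?r) \<noteq> 0"
      using x_ne by simp
    \<comment> \<open>An acyclic cell with the same parent equals \<open>?r\<close>, and cyclic
      siblings lie outside the support, so one summand remains.\<close>
    have "(\<Sum>r'\<in>{r' \<in> R. par r' = par ?r}. v (ent r')) = (\<Sum>r'\<in>{?r}. v (ent r'))"
    proof (rule sum.mono_neutral_right)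
      show "finite {r' \<in> R. par r' = par ?r}" using fin_R by simp
      show "{?r} \<subseteq> {r' \<in> R. par r' = par ?r}" using r by simp
      show "\<forall>r'\<in>{r' \<in> R. par r' = par ?r} - {?r}. v (ent r') = 0"
      proof
        fix r' assume r': "r' \<in> {r' \<in> R. par r' = par ?r} - {?r}"
        then have "c r' \<noteq> 0"
          using acyclic_par_inj[of r' ?r] r by auto
        then have "r' \<notin> Z"
          using acyclic by blast
        then show "v (ent r') = 0"
          using ent_Z r' by simp
      qed
    qed
    moreover have "(\<Sum>r'\<in>{r' \<in> R. par r' = par ?r}. v (ent r')) = 0"
    proof (cases "par ?r")
      case (Inl s)
      then show ?thesis using input by simp
    next
      case (Inr y)
      then have "y \<in> X" "c (cell y) = 0"
        using par_in acyclic_par r by auto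
      then show ?thesis
        using node[of y] True Inr by simp
    qed
    ultimately show False
      using v_ent by simp
  next
    case False
    \<comment> \<open>Descending through supported children ends at a leaf, whose weight is
      \<open>cmod \<mu>\<close>. Distinct positive weights make this leaf the same for all starting
      cells.\<close>
    have "\<exists>p\<in>Z. cmod \<mu> = c p \<and> (r, p) \<in> Ch\<^sup>*" if "r \<in> Z" for r
      using that
    proof (induction "Max (rk ` Z) - rk r" arbitrary: r rule: less_induct)
      case less
      show ?case
      proof (cases "\<exists>r'\<in>Z. (r, r') \<in> Ch")
        case True
        then obtain r' where r': "r' \<in> Z" "(r, r') \<in> Ch" by blast
        have "rk r' \<le> Max (rk ` Z)"
          using fin_Z r' by (intro Max_ge) auto
        then have "Max (rk ` Z) - rk r' < Max (rk ` Z) - rk r"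
          using Ch_rk[OF r'(2)] by linarith
        then show ?thesis
          using less.hyps[of r'] r' by (meson converse_rtrancl_into_rtrancl)
      next
        case False
        then show ?thesis
          using leaf[OF less.prems] less.prems by blast
      qed
    qed
    moreover have "p = p'" if "p \<in> Z" "p' \<in> Z" "cmod \<mu> = c p" "cmod \<mu> = c p'" for p p'
    proof -
      have "0 < c p"
        using that(3) False by (metis zero_less_norm_iff)
      then show ?thesis
        using that Z_R c_inj[of p p'] by auto
    qed
    ultimately obtain p where anc: "\<And>r. r \<in> Z \<Longrightarrow> (r, p) \<in> Ch\<^sup>*"
      using Z_ne by metis
    \<comment> \<open>Every cell has at most one parent, so the ancestors of \<open>p\<close> form a
      chain.\<close>
    have "single_valued (Ch\<inverse>)"
      by (auto simp: single_valued_def Ch_def)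
    then have comparable: "(r, r') \<in> Ch\<^sup>* \<or> (r', r) \<in> Ch\<^sup>*" if "r \<in> Z" "r' \<in> Z" for r r'
      using single_valued_confluent[of "Ch\<inverse>" p r r'] anc that by (auto simp: rtrancl_converse)
    have child_unique: "r1 = r2" if "r1 \<in> Z" "r2 \<in> Z" "(q, r1) \<in> Ch" "(q, r2) \<in> Ch" for q r1 r2
    proof -
      have *: "r1 = r2" if "(r1, r2) \<in> Ch\<^sup>*" "(q, r1) \<in> Ch" "(q, r2) \<in> Ch" for r1 r2
        using that(1)
      proof (cases rule: rtranclE)
        case (step y)
        then have "y = q"
          using that(3) by (auto simp: Ch_def)
        then show ?thesis
          using Ch_rtrancl_rk[OF step(1)] Ch_rk[OF that(2)] by simp
      qed
      show ?thesis
        using comparable[of r1 r2] *[of r1 r2] *[of r2 r1] that by auto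
    qed
    have par_unique: "r1 = r2" if "r1 \<in> Z" "r2 \<in> Z" "par r1 = par r2" for r1 r2
    proof (cases "par r1")
      case (Inr y)
      then show ?thesis
        using child_unique[of r1 r2 "cell y"] that Z_R by (auto simp: Ch_def)
    next
      case (Inl s)
      have *: "r1 = r2" if "(r1, r2) \<in> Ch\<^sup>*" "par r2 = Inl s" for r1 r2
        using that(1) by (cases rule: rtranclE) (use that(2) in \<open>auto simp: Ch_def\<close>)
      show ?thesis
        using comparable[of r1 r2] *[of r1 r2] *[of r2 r1] that Inl by auto
    qed
    have nowhere_zero: "v y \<noteq> 0" if r: "cell y \<in> Z" and y: "y \<in> X" for y
    proof (cases "c (cell y) = 0")
      case True
      then show ?thesis
        using r y acyclic_singleton by (force simp: Z_def)
    next
      case c_ne: False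
      let ?r = "cell y"
      obtain y' where y': "y' \<in> X" "cell y' = ?r" "v y' \<noteq> 0"
        using r by (auto simp: Z_def)
      \<comment> \<open>Supported children can hang only from \<open>b\<close>; if there are none,
        any node of the cell serves as \<open>b\<close>. At every other node the equation is
        \<open>\<mu> * v z = c ?r * v (nx z)\<close> with both factors nonzero, so nonvanishing
        spreads over the cell.\<close>
      obtain b where b: "b \<in> X" "cell b = ?r"
        and b_uniq: "\<And>r'. r' \<in> Z \<Longrightarrow> (?r, r') \<in> Ch \<Longrightarrow> par r' = Inr b"
      proof (cases "\<exists>r'\<in>Z. (?r, r') \<in> Ch")
        case True
        then obtain r' where r': "r' \<in> Z" "(?r, r') \<in> Ch" by blast
        then obtain b where b: "par r' = Inr b" "cell b = ?r"
          by (auto simp: Ch_def)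
        show thesis
          using that[of b] b r' par_in[of r' b] Z_R child_unique by blast
      next
        case False
        then show thesis
          using that[of y] y by blast
      qed
      have "(v y \<noteq> 0) \<longleftrightarrow> (v y' \<noteq> 0)"
      proof (rule cell_propagate[where r = ?r and b = b])
        fix z assume z: "z \<in> X" "cell z = ?r" "z \<noteq> b"
        have "r' \<notin> Z" if "r' \<in> R" "par r' = Inr z" for r'
          using b_uniq[of r'] z that by (auto simp: Ch_def)
        then have "(\<Sum>r\<in>{r \<in> R. par r = Inr z}. v (ent r)) = 0"
          by (intro sum.neutral) (auto intro: ent_Z)
        then have "\<mu> * v z = c ?r * v (nx z)"
          using node[OF z(1)] z by simp
        then show "(v z \<noteq> 0) \<longleftrightarrow> (v (nx z) \<noteq> 0)"
          using False c_ne by (metis mult_eq_0_iff of_real_eq_0_iff)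
      qed (use y y' b in auto)
      then show ?thesis
        using y' by simp
    qed
    \<comment> \<open>\<open>r\<close> is the topmost supported cell. If its parent is a node,
      \<open>v\<close> vanishes there and at its successor, so the parent's equation leaves only
      \<open>v (ent r) = 0\<close>.\<close>
    obtain r where r: "r \<in> Z" and rmin: "\<And>r'. r' \<in> Z \<Longrightarrow> rk r \<le> rk r'"
      using ex_has_least_nat[of "\<lambda>r. r \<in> Z" _ rk] Z_ne by metis
    have rR: "r \<in> R" using r Z_R by blast
    have "v (ent r) \<noteq> 0"
      using r rR by (intro nowhere_zero) (auto simp: cell_ent ent_in)
    moreover have "(\<Sum>r'\<in>{r' \<in> R. par r' = par r}. v (ent r')) = (\<Sum>r'\<in>{r}. v (ent r'))"
    proof (rule sum.mono_neutral_right)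
      show "finite {r' \<in> R. par r' = par r}" using fin_R by simp
      show "{r} \<subseteq> {r' \<in> R. par r' = par r}" using rR by simp
      show "\<forall>r'\<in>{r' \<in> R. par r' = par r} - {r}. v (ent r') = 0"
        using par_unique[of _ r] r ent_Z by auto
    qed
    moreover have "(\<Sum>r'\<in>{r' \<in> R. par r' = par r}. v (ent r')) = 0"
    proof (cases "par r")
      case (Inl s)
      then show ?thesis using input by simp
    next
      case (Inr y)
      then have y: "y \<in> X" "rk (cell y) < rk r"
        using par_in par_rk rR by auto
      then have "cell y \<notin> Z"
        using rmin by force
      then have "v y = 0" "v (nx y) = 0"
        using y not_Z by (simp_all add: nx_in cell_nx)
      then show ?thesis
        using node[OF y(1)] Inr by simp
    qed
    ultimately show False by simp
  qed
qed

section \<open>Edge weights as matrix entries\<close>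

text \<open>The weight of the edge from \<open>x\<close> to \<open>y\<close>, in the order of row
  and column of \<open>A\<close>. The two summands are never both nonzero, since
  \<open>par_rk\<close> puts a parent into a different cell.\<close>

definition state_weight :: "'a \<Rightarrow> 'a \<Rightarrow> real" where
  "state_weight y x = (if y = nx x then c (cell x) else 0) +
     (if y = ent (cell y) \<and> par (cell y) = Inr x then 1 else 0)"

definition input_weight :: "'a \<Rightarrow> 'i \<Rightarrow> real" where
  "input_weight y s = (if y = ent (cell y) \<and> par (cell y) = Inl s then 1 else 0)"

lemma sum_entries:
  fixes v :: "'a \<Rightarrow> complex"
  shows "(\<Sum>y\<in>X. v y * complex_of_real (if y = ent (cell y) \<and> par (cell y) = a then 1 else 0))
     = (\<Sum>r\<in>{r \<in> R. par r = a}. v (ent r))"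
proof -
  have "(\<Sum>y\<in>X. v y * complex_of_real (if y = ent (cell y) \<and> par (cell y) = a then 1 else 0))
      = (\<Sum>y\<in>{y \<in> X. y = ent (cell y) \<and> par (cell y) = a}. v y)"
    using fin_X by (subst sum.inter_filter) (auto intro!: sum.cong)
  also have "{y \<in> X. y = ent (cell y) \<and> par (cell y) = a} = ent ` {r \<in> R. par r = a}"
    by (auto simp: ent_in cell_ent cell_in image_iff)
  also have "sum v \<dots> = (\<Sum>r\<in>{r \<in> R. par r = a}. v (ent r))"
    by (subst sum.reindex) (auto intro: inj_on_inverseI[of _ cell] simp: cell_ent)
  finally show ?thesis .
qed

text \<open>Input equations are asked only for parents of cells, which are genuine columns of
  \<open>B\<close>; for any other \<open>s\<close> the sum is empty.\<close>

lemma left_eigenvector_zero: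
  fixes v :: "'a \<Rightarrow> complex" and \<mu> :: complex
  assumes state: "\<And>x. x \<in> X \<Longrightarrow> (\<Sum>y\<in>X. v y * state_weight y x) = \<mu> * v x"
    and input: "\<And>r s. r \<in> R \<Longrightarrow> par r = Inl s \<Longrightarrow> (\<Sum>y\<in>X. v y * input_weight y s) = 0"
    and x: "x \<in> X"
  shows "v x = 0"
proof (rule eigenvector_zero[where \<mu> = \<mu>, OF _ _ x])
  fix x assume x: "x \<in> X"
  have "(\<Sum>y\<in>X. v y * state_weight y x) = (\<Sum>y\<in>X. if y = nx x then v y * c (cell x) else 0) +
      (\<Sum>y\<in>X. v y * complex_of_real (if y = ent (cell y) \<and> par (cell y) = Inr x then 1 else 0))"
    unfolding sum.distrib[symmetric] by (intro sum.cong) (auto simp: state_weight_def algebra_simps)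
  then show "\<mu> * v x = c (cell x) * v (nx x) + (\<Sum>r\<in>{r \<in> R. par r = Inr x}. v (ent r))"
    using state[OF x] sum_entries[of v "Inr x"] fin_X nx_in[OF x] by (simp add: mult.commute)
next
  fix s
  show "(\<Sum>r\<in>{r \<in> R. par r = Inl s}. v (ent r)) = 0"
  proof (cases "\<exists>r\<in>R. par r = Inl s")
    case True
    then show ?thesis
      using input sum_entries[of v "Inl s"] by (auto simp: input_weight_def)
  next
    case False
    then show ?thesis
      by (intro sum.neutral) auto
  qed
qed

end

section \<open>The forest of a covering by stems and cycles\<close>

lemma vwalk_arcs_nth:
  assumes "Suc k < length p"
  shows "(p ! k, p ! Suc k) \<in> set (vwalk_arcs p)"
  using assms
proof (induction p arbitrary: k rule: vwalk_arcs.induct)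
  case (3 x y xs)
  then show ?case by (cases k) auto
qed auto

lemma vwalk_take:
  assumes "vwalk p G" "0 < k"
  shows "vwalk (take k p) G"
proof -
  have "set (vwalk_arcs (take k p)) \<subseteq> set (vwalk_arcs p)"
  proof (induction p arbitrary: k rule: vwalk_arcs.induct)
    case (3 x y xs)
    show ?case
    proof (cases k)
      case (Suc k')
      then show ?thesis
        using 3[of k'] by (cases k') auto
    qed simp
  qed (auto simp: take_Cons')
  then show ?thesis
    using assms set_take_subset[of k p] by (auto simp: vwalk_def)
qed

abbreviation edge :: "structured_system \<Rightarrow> node \<Rightarrow> node \<Rightarrow> bool" where
  "edge S a b \<equiv> (a, b) \<in> arcs_ends (system_graph S)"

lemma edge_State_State:
  "edge S (State i) (State j) \<longleftrightarrow> i < state_dim S \<and> j < state_dim S \<and> Amat S $$ (j, i) = Free"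
  by (auto simp: system_graph_def with_proj_def arcs_ends_def arc_to_ends_def image_iff)

lemma edge_Input_State:
  "edge S (Input s) (State j) \<longleftrightarrow> s < input_dim S \<and> j < state_dim S \<and> Bmat S $$ (j, s) = Free"
  by (auto simp: system_graph_def with_proj_def arcs_ends_def arc_to_ends_def image_iff)

lemma edge_to_State: "edge S a b \<Longrightarrow> b \<in> range State"
  by (auto simp: system_graph_def with_proj_def arcs_ends_def arc_to_ends_def image_iff)

lemma State_in_verts: "State i \<in> verts (system_graph S) \<longleftrightarrow> i < state_dim S"
  by (auto simp: system_graph_def with_proj_def)

lemma vwalk_edge:
  assumes "vwalk p (system_graph S)" "Suc k < length p"
  shows "edge S (p ! k) (p ! Suc k)"
  using assms vwalk_arcs_nth by (blast elim: vwalkE)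

lemma stem_edge: "stem S p \<Longrightarrow> Suc k < length p \<Longrightarrow> edge S (p ! k) (p ! Suc k)"
  by (auto simp: stem_def vpath_def intro: vwalk_edge)

lemma cycle_edge: "cycle S p \<Longrightarrow> Suc k < length p \<Longrightarrow> edge S (p ! k) (p ! Suc k)"
  by (auto simp: cycle_def intro: vwalk_edge)

text \<open>Every node of a cycle is the end of an edge, the first one because it is also the last,
  and no edge ends at an input.\<close>

lemma cycle_set:
  assumes "cycle S p"
  shows "set p \<subseteq> range State"
proof
  fix x assume "x \<in> set p"
  then obtain k where k: "k < length p" "x = p ! k"
    by (auto simp: in_set_conv_nth)
  have len: "2 \<le> length p" and hd_last: "hd p = last p"
    using assms by (auto simp: cycle_def)
  then have ne: "p \<noteq> []" by auto
  obtain j where j: "Suc j < length p" "x = p ! Suc j"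
  proof (cases k)
    case 0
    then have "x = p ! Suc (length p - 2)"
      using k len hd_last ne by (simp add: hd_conv_nth last_conv_nth Suc_diff_Suc numeral_2_eq_2)
    moreover have "Suc (length p - 2) < length p"
      using len by linarith
    ultimately show thesis
      using that by blast
  next
    case (Suc j)
    then show thesis using that k by blast
  qed
  then show "x \<in> range State"
    using cycle_edge[OF assms j(1)] edge_to_State by blast
qed

lemma not_stem_and_cycle: "stem S p \<Longrightarrow> \<not> cycle S p"
  by (auto simp: stem_def cycle_def)

text \<open>The function is the length of a shortest stem ending in a given state.\<close>

lemma input_accessible_distance:
  assumes "input_accessible S"
  shows "\<exists>dist :: nat \<Rightarrow> nat. \<forall>i<state_dim S. (\<exists>s. edge S (Input s) (State i)) \<or>
     (\<exists>j. edge S (State j) (State i) \<and> dist j < dist i)"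
proof (intro exI allI impI)
  define dist where "dist i = (LEAST l. \<exists>p. stem S p \<and> last p = State i \<and> length p = l)" for i
  fix i assume "i < state_dim S"
  then have "\<exists>l p. stem S p \<and> last p = State i \<and> length p = l"
    using assms by (auto simp: input_accessible_def)
  then have "\<exists>p. stem S p \<and> last p = State i \<and> length p = dist i"
    unfolding dist_def by (rule LeastI_ex)
  then obtain p where p: "stem S p" "last p = State i" "length p = dist i"
    by blast
  have ne: "p \<noteq> []"
    using p(1) by (auto simp: stem_def vpath_def vwalk_def)
  have "length p \<noteq> 1"
    using p(1,2) by (auto simp: stem_def length_Suc_conv)
  then obtain k where k: "length p = Suc (Suc k)"
    using ne by (metis One_nat_def length_0_conv not0_implies_Suc)
  have e: "edge S (p ! k) (State i)"
    using stem_edge[OF p(1), of k] k p(2) ne by (simp add: last_conv_nth)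
  show "(\<exists>s. edge S (Input s) (State i)) \<or> (\<exists>j. edge S (State j) (State i) \<and> dist j < dist i)"
  proof (cases "p ! k")
    case (Input s)
    then show ?thesis using e by auto
  next
    case (State j)
    \<comment> \<open>Dropping the last node leaves a stem to the predecessor, of length one less
      than \<open>dist i\<close>.\<close>
    let ?q = "take (Suc k) p"
    have "last ?q = State j"
      using State k by (simp add: take_Suc_conv_app_nth)
    moreover have "hd ?q = hd p"
      using ne by (simp add: hd_take)
    ultimately have "stem S ?q"
      using p(1) vwalk_take[of p _ "Suc k"] by (auto simp: stem_def vpath_def)
    then have "dist j \<le> Suc k"
      unfolding dist_def using \<open>last ?q = State j\<close> k by (intro Least_le exI[of _ ?q]) auto
    then show ?thesis
      using e State k p(3) by auto
  qed
qed

section \<open>Positions on stems and cycles\<close>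

fun state_index :: "node \<Rightarrow> nat" where
  "state_index (State i) = i"
| "state_index (Input s) = s"

text \<open>In a cycle the starting node occurs at both ends of the list; the least position is the
  one that has a successor.\<close>

definition first_index :: "'a list \<Rightarrow> 'a \<Rightarrow> nat" where
  "first_index p x = (LEAST k. p ! k = x)"

lemma first_index:
  assumes "x \<in> set p"
  shows "p ! first_index p x = x" "first_index p x < length p"
proof -
  obtain k where k: "k < length p" "p ! k = x"
    using assms by (auto simp: in_set_conv_nth)
  show "p ! first_index p x = x"
    unfolding first_index_def by (rule LeastI) (rule k(2))
  have "first_index p x \<le> k"
    unfolding first_index_def using k(2) by (rule Least_le)
  then show "first_index p x < length p"
    using k by simp
qed

lemma cycle_nth_eq_iff:
  assumes "cycle S p" "j < length p - 1" "k < length p - 1"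
  shows "p ! j = p ! k \<longleftrightarrow> j = k"
proof -
  have "distinct (butlast p)"
    using assms(1) by (simp add: cycle_def)
  then show ?thesis
    using nth_eq_iff_index_eq[of "butlast p" j k] assms(2,3) by (metis length_butlast nth_butlast)
qed

lemma cycle_last:
  assumes "cycle S p"
  shows "p ! (length p - 1) = p ! 0"
proof -
  have "p \<noteq> []" "hd p = last p"
    using assms by (auto simp: cycle_def)
  then show ?thesis
    by (metis hd_conv_nth last_conv_nth)
qed

lemma cycle_first_index:
  assumes "cycle S p" "k < length p - 1"
  shows "first_index p (p ! k) = k"
proof -
  have *: "p ! k \<in> set p"
    using assms by simp
  have "first_index p (p ! k) \<le> k"
    unfolding first_index_def by (rule Least_le) simp
  then show ?thesis
    using cycle_nth_eq_iff[of S p "first_index p (p ! k)" k] assms first_index[OF *] by simp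
qed

lemma cycle_first_index_less:
  assumes "cycle S p" "x \<in> set p"
  shows "Suc (first_index p x) < length p"
proof (rule ccontr)
  assume "\<not> ?thesis"
  then have "first_index p x = length p - 1"
    using first_index[OF assms(2)] by linarith
  moreover have "p ! 0 = x"
    using calculation first_index(1)[OF assms(2)] cycle_last[OF assms(1)] by simp
  then have "first_index p x \<le> 0"
    unfolding first_index_def by (intro Least_le)
  ultimately show False
    using assms(1) by (simp add: cycle_def)
qed

text \<open>The nodes of the extended graph are the pairs \<open>(i, p)\<close>: each state is split into one copy
  for every member of \<open>P\<close> passing through it. A stem contributes one singleton cell per state, a
  cycle contributes one cell.\<close>

locale stem_cycle_cover =
  fixes S :: structured_system and P :: "node list set"
    and code :: "node list \<Rightarrow> nat" and dist :: "nat \<Rightarrow> nat"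
    and src :: "nat \<Rightarrow> nat + nat" and cov :: "nat \<Rightarrow> node list"
  assumes fin_P: "finite P" and code_inj: "inj_on code P"
    and members: "p \<in> P \<Longrightarrow> stem S p \<or> cycle S p"
    and stems: "p \<in> P \<Longrightarrow> q \<in> P \<Longrightarrow> stem S p \<Longrightarrow> stem S q \<Longrightarrow> hd p = hd q \<Longrightarrow> p = q"
    and src_Inl: "i < state_dim S \<Longrightarrow> src i = Inl s \<Longrightarrow> edge S (Input s) (State i)"
    and src_Inr: "i < state_dim S \<Longrightarrow> src i = Inr j \<Longrightarrow> edge S (State j) (State i)"
    and src_dist: "i < state_dim S \<Longrightarrow> src i = Inr j \<Longrightarrow> dist j < dist i"
    and cov: "i < state_dim S \<Longrightarrow> cov i \<in> P" "i < state_dim S \<Longrightarrow> State i \<in> set (cov i)"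
begin

section \<open>The cells of the chosen members\<close>

definition nodes :: "(nat \<times> node list) set" where
  "nodes = {(i, p). p \<in> P \<and> State i \<in> set p}"

text \<open>\<open>Some i\<close> labels the singleton cell of state \<open>i\<close> on a stem,
  \<open>None\<close> the whole of a cycle.\<close>

fun cell :: "nat \<times> node list \<Rightarrow> node list \<times> nat option" where
  "cell (i, p) = (p, if stem S p then Some i else None)"

definition cells :: "(node list \<times> nat option) set" where
  "cells = cell ` nodes"

text \<open>A stem node is its own orbit; the weight 0 of its cell removes the resulting loop from
  \<open>A\<close>.\<close>

fun nx :: "nat \<times> node list \<Rightarrow> nat \<times> node list" where
  "nx (i, p) = (if stem S p then i else state_index (p ! Suc (first_index p (State i))), p)"

text \<open>\<open>Suc\<close> keeps cycle weights positive, and injectivity of \<open>code\<close>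
  on \<open>P\<close> makes them distinct.\<close>

fun wt :: "node list \<times> nat option \<Rightarrow> real" where
  "wt (p, None) = real (Suc (code p))"
| "wt (p, Some i) = 0"

text \<open>The accessing edge enters a cycle at a state of least distance, so a source that is a
  state is closer to the inputs than the whole cycle.\<close>

definition nearest :: "node list \<Rightarrow> nat" where
  "nearest p = arg_min_on dist {i. State i \<in> set p}"

fun ent :: "node list \<times> nat option \<Rightarrow> nat \<times> node list" where
  "ent (p, None) = (nearest p, p)"
| "ent (p, Some i) = (i, p)"

text \<open>A stem state hangs from its predecessor on the same stem. A cycle hangs from the source
  of its nearest state; if that source is a state \<open>j\<close>, its copy in \<open>cov j\<close>
  is used.\<close>

fun par :: "node list \<times> nat option \<Rightarrow> nat + nat \<times> node list" where
  "par (p, None) = map_sum id (\<lambda>j. (j, cov j)) (src (nearest p))"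
| "par (p, Some i) = (case p ! (first_index p (State i) - 1) of Input s \<Rightarrow> Inl s | State j \<Rightarrow> Inr (j, p))"

text \<open>The total length of the members exceeds every position on a stem, so stem cells rank
  below cycles; cycles are ordered by distance.\<close>

fun rk :: "node list \<times> nat option \<Rightarrow> nat" where
  "rk (p, None) = (\<Sum>q\<in>P. length q) + dist (nearest p)"
| "rk (p, Some i) = first_index p (State i)"

lemma state_less:
  assumes "p \<in> P" "State i \<in> set p"
  shows "i < state_dim S"
proof -
  have "set p \<subseteq> verts (system_graph S)"
    using members[OF assms(1)] by (auto simp: stem_def cycle_def vpath_def vwalk_def)
  then show ?thesis
    using assms(2) State_in_verts by blast
qed

lemma finite_nodes: "finite nodes"
proof (rule finite_subset)
  show "nodes \<subseteq> {..<state_dim S} \<times> P"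
    using state_less by (auto simp: nodes_def)
qed (use fin_P in simp)

lemma cells_cases:
  assumes "r \<in> cells"
  obtains (stem) p i where "r = (p, Some i)" "p \<in> P" "stem S p" "State i \<in> set p"
  | (cycle) p where "r = (p, None)" "p \<in> P" "cycle S p" "\<not> stem S p"
proof -
  obtain i p where "p \<in> P" "State i \<in> set p" "r = cell (i, p)"
    using assms by (auto simp: cells_def nodes_def)
  then show thesis
    using stem[of p i] cycle[of p] members[of p] by (cases "stem S p") auto
qed

lemma cycle_cell:
  assumes "r \<in> cells" "0 < wt r"
  obtains p where "r = (p, None)" "p \<in> P"
  using assms(1)
proof (cases rule: cells_cases)
  case (stem p i)
  then show thesis using assms(2) by simp
next
  case (cycle p)
  then show thesis by (intro that)
qed

lemma stem_cell:
  assumes "r \<in> cells" "wt r = 0"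
  obtains p i where "r = (p, Some i)" "p \<in> P" "stem S p" "State i \<in> set p"
  using assms(1)
proof (cases rule: cells_cases)
  case (stem p i)
  then show thesis by (intro that)
next
  case (cycle p)
  then show thesis using assms(2) by simp
qed

lemma nearest:
  assumes "p \<in> P" "cycle S p"
  shows "State (nearest p) \<in> set p" "State i \<in> set p \<Longrightarrow> dist (nearest p) \<le> dist i"
proof -
  let ?I = "{i. State i \<in> set p}"
  have fin: "finite ?I"
    using finite_vimageI[of "set p" State] by (auto simp: vimage_def inj_def)
  have "p \<noteq> []" using assms(2) by (auto simp: cycle_def)
  then have hd: "hd p \<in> set p" by simp
  then obtain h where "hd p = State h"
    using cycle_set[OF assms(2)] by blast
  then have "h \<in> ?I"
    using hd by simp
  then have ne: "?I \<noteq> {}" by blast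
  show "State (nearest p) \<in> set p"
    using arg_min_if_finite(1)[OF fin ne, of dist] by (simp add: nearest_def)
  show "dist (nearest p) \<le> dist i" if "State i \<in> set p"
    using arg_min_least[OF fin ne, of i dist] that by (simp add: nearest_def)
qed

section \<open>Predecessors and successors as edges\<close>

text \<open>A stem starts at an input, so a state on it never has position 0 and the subtraction in
  \<open>par\<close> does not truncate.\<close>

lemma stem_first_index:
  assumes "stem S p" "State i \<in> set p"
  obtains k where "first_index p (State i) = Suc k" "Suc k < length p" "p ! Suc k = State i"
proof (cases "first_index p (State i)")
  case 0
  then have "p ! 0 = State i" "p \<noteq> []"
    using first_index[OF assms(2)] by auto
  then show thesis
    using assms(1) by (auto simp: stem_def hd_conv_nth)
next
  case (Suc k)
  then show thesis
    using that first_index[OF assms(2)] by metis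
qed

text \<open>Inputs have no incoming edges, so a predecessor that is an input is the head of the
  stem. Distinctness fixes the position of a predecessor that is a state.\<close>

lemma par_stem_edge:
  assumes "stem S p" "State i \<in> set p"
  shows "par (p, Some i) = Inl s \<Longrightarrow> edge S (Input s) (State i) \<and> s = state_index (hd p)"
    and "par (p, Some i) = Inr x \<Longrightarrow> edge S (State (fst x)) (State i) \<and> snd x = p
       \<and> State (fst x) \<in> set p \<and> Suc (first_index p (State (fst x))) = first_index p (State i)"
proof -
  obtain k where k: "first_index p (State i) = Suc k" "Suc k < length p" "p ! Suc k = State i"
    using stem_first_index[OF assms] by blast
  have e: "edge S (p ! k) (State i)"
    using stem_edge[OF assms(1), of k] k by simp
  have dist_p: "distinct p"
    using assms(1) by (simp add: stem_def vpath_def)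
  show "edge S (Input s) (State i) \<and> s = state_index (hd p)" if par: "par (p, Some i) = Inl s"
  proof -
    have pk: "p ! k = Input s"
      using par k by (cases "p ! k") auto
    have "k = 0"
    proof (rule ccontr)
      assume "k \<noteq> 0"
      then obtain l where "k = Suc l" by (cases k) auto
      then show False
        using stem_edge[OF assms(1), of l] edge_to_State k(2) pk by force
    qed
    then have "hd p = Input s"
      using pk k(2) by (subst hd_conv_nth) auto
    then show ?thesis
      using e pk by simp
  qed
  show "edge S (State (fst x)) (State i) \<and> snd x = p \<and> State (fst x) \<in> set p
       \<and> Suc (first_index p (State (fst x))) = first_index p (State i)" if par: "par (p, Some i) = Inr x"
  proof -
    obtain j where j: "p ! k = State j" "x = (j, p)"
      using par k by (cases "p ! k") auto
    have "State j \<in> set p"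
      using j(1) k(2) by (metis Suc_lessD nth_mem)
    moreover have "first_index p (State j) = k"
      using first_index[OF \<open>State j \<in> set p\<close>] j(1) k(2) dist_p
      by (metis Suc_lessD nth_eq_iff_index_eq)
    ultimately show ?thesis
      using e j k(1) by simp
  qed
qed

lemma par_Inl_edge:
  assumes "r \<in> cells" "par r = Inl s"
  shows "edge S (Input s) (State (fst (ent r)))"
  using assms(1)
proof (cases rule: cells_cases)
  case (stem p i)
  then show ?thesis
    using par_stem_edge(1)[of p i s] assms(2) by (auto simp del: par.simps)
next
  case (cycle p)
  then have "src (nearest p) = Inl s"
    using assms(2) by (cases "src (nearest p)") auto
  then show ?thesis
    using src_Inl state_less nearest(1) cycle by auto
qed

lemma par_Inr_edge:
  assumes "r \<in> cells" "par r = Inr x"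
  shows "edge S (State (fst x)) (State (fst (ent r)))"
  using assms(1)
proof (cases rule: cells_cases)
  case (stem p i)
  then show ?thesis
    using par_stem_edge(2)[of p i x] assms(2) by (auto simp del: par.simps)
next
  case (cycle p)
  then have "src (nearest p) = Inr (fst x)"
    using assms(2) by (cases "src (nearest p)") auto
  then show ?thesis
    using src_Inr state_less nearest(1) cycle by auto
qed

text \<open>The list repeats its first node at the end, so positions count modulo
  \<open>length p - 1\<close>, the number of distinct nodes.\<close>

lemma nx_cycle:
  assumes "cycle S p" "k < length p - 1" "p ! k = State i"
  shows "nx (i, p) = (state_index (p ! (Suc k mod (length p - 1))), p)"
proof -
  have "first_index p (State i) = k"
    using cycle_first_index[OF assms(1,2)] by (simp only: assms(3))
  moreover have "p ! Suc k = p ! (Suc k mod (length p - 1))"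
  proof (cases "Suc k < length p - 1")
    case False
    then have "Suc k = length p - 1" using assms(2) by simp
    then show ?thesis
      using cycle_last[OF assms(1)] by simp
  qed simp
  moreover have "\<not> stem S p"
    using assms(1) not_stem_and_cycle by blast
  ultimately show ?thesis
    by (simp only: nx.simps if_False)
qed

lemma nx_pow_cycle:
  assumes "cycle S p" "j < length p - 1"
  shows "(nx ^^ k) (state_index (p ! j), p) = (state_index (p ! ((j + k) mod (length p - 1))), p)"
proof (induction k)
  case 0
  have "(j + 0) mod (length p - 1) = j"
    using assms(2) by simp
  then show ?case by (simp only: funpow_0)
next
  case (Suc k)
  let ?l = "(j + k) mod (length p - 1)"
  have l: "?l < length p - 1"
    using assms(2) by (intro mod_less_divisor) simp
  then have "p ! ?l \<in> set p" by (intro nth_mem) simp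
  then obtain i where i: "p ! ?l = State i"
    using cycle_set[OF assms(1)] by blast
  have "(nx ^^ Suc k) (state_index (p ! j), p) = nx (state_index (p ! ?l), p)"
    using Suc.IH by simp
  also have "\<dots> = nx (i, p)"
    by (simp only: i state_index.simps)
  also have "\<dots> = (state_index (p ! (Suc ?l mod (length p - 1))), p)"
    by (rule nx_cycle[OF assms(1) l i])
  also have "Suc ?l mod (length p - 1) = (j + Suc k) mod (length p - 1)"
    by (simp only: mod_Suc_eq add_Suc_right)
  finally show ?case .
qed

lemma nx_edge:
  assumes "x \<in> nodes" "wt (cell x) \<noteq> 0"
  shows "edge S (State (fst x)) (State (fst (nx x)))" and "nx x \<in> nodes"
proof -
  obtain i p where x: "x = (i, p)" by (cases x)
  have p: "p \<in> P" "State i \<in> set p" "\<not> stem S p"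
    using assms x by (auto simp: nodes_def)
  then have cyc: "cycle S p" using members by blast
  let ?k = "first_index p (State i)"
  have k: "Suc ?k < length p" "p ! ?k = State i"
    using cycle_first_index_less[OF cyc p(2)] first_index[OF p(2)] by auto
  have e: "edge S (State i) (p ! Suc ?k)"
    using cycle_edge[OF cyc k(1)] k(2) by simp
  have "p ! Suc ?k \<in> set p"
    using k(1) by simp
  moreover obtain j where j: "p ! Suc ?k = State j"
    using edge_to_State[OF e] by blast
  ultimately show "edge S (State (fst x)) (State (fst (nx x)))" "nx x \<in> nodes"
    using e p x by (auto simp: nodes_def)
qed

section \<open>The forest conditions\<close>

sublocale cell_forest nodes cells cell nx wt ent par rk
proof
  show "finite nodes" by (rule finite_nodes)
  then show "finite cells" by (simp add: cells_def)
  show "cell x \<in> cells" if "x \<in> nodes" for x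
    using that by (simp add: cells_def)
  show "nx x \<in> nodes" if "x \<in> nodes" for x
  proof (cases "stem S (snd x)")
    case True
    then have "nx x = x" by (cases x) simp
    then show ?thesis using that by simp
  next
    case False
    then show ?thesis
      using nx_edge(2)[OF that] by (cases x) simp
  qed
  show "cell (nx x) = cell x" for x
    by (cases x) simp
  show "\<exists>k. y = (nx ^^ k) x" if xy: "x \<in> nodes" "y \<in> nodes" "cell x = cell y" for x y
  proof -
    obtain i p where x: "x = (i, p)" by (cases x)
    obtain j where y: "y = (j, p)" using x xy(3) by (cases y) auto
    show ?thesis
    proof (cases "stem S p")
      case True
      then have "y = (nx ^^ 0) x" using x y xy(3) by simp
      then show ?thesis by blast
    next
      case False
      then have cyc: "cycle S p" using members xy(1) x by (auto simp: nodes_def)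
      let ?L = "length p - 1"
      define a where "a = first_index p (State i)"
      define b where "b = first_index p (State j)"
      have ij: "State i \<in> set p" "State j \<in> set p"
        using xy x y by (auto simp: nodes_def)
      have ab: "a < ?L" "b < ?L" "p ! a = State i" "p ! b = State j"
        using cycle_first_index_less[OF cyc ij(1)] cycle_first_index_less[OF cyc ij(2)]
          first_index(1)[OF ij(1)] first_index(1)[OF ij(2)] by (auto simp: a_def b_def)
      \<comment> \<open>Adding a full turn, \<open>?L - a + b\<close> steps lead from position
        \<open>a\<close> to \<open>b\<close> whether or not \<open>a \<le> b\<close>.\<close>
      have "(nx ^^ (?L - a + b)) x = (state_index (p ! ((a + (?L - a + b)) mod ?L)), p)"
        using nx_pow_cycle[OF cyc ab(1)] ab(3) x by (metis state_index.simps(1))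
      also have "a + (?L - a + b) = b + ?L"
        using ab(1) by simp
      also have "(b + ?L) mod ?L = b"
        by (simp only: mod_add_self2 mod_less[OF ab(2)])
      finally have "(nx ^^ (?L - a + b)) x = y"
        using ab(4) y by simp
      then show ?thesis by metis
    qed
  qed
  show "ent r \<in> nodes" "cell (ent r) = r" if r: "r \<in> cells" for r
  proof -
    have "ent r \<in> nodes \<and> cell (ent r) = r"
      using r by (cases rule: cells_cases) (simp_all add: nodes_def nearest(1))
    then show "ent r \<in> nodes" "cell (ent r) = r" by simp_all
  qed
  show "x \<in> nodes" if r: "r \<in> cells" "par r = Inr x" for r x
    using r(1)
  proof (cases rule: cells_cases)
    case (stem p i)
    then show ?thesis
      using par_stem_edge(2)[of p i x] r(2) by (cases x) (auto simp: nodes_def simp del: par.simps)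
  next
    case (cycle p)
    then obtain j where j: "src (nearest p) = Inr j" "x = (j, cov j)"
      using r(2) by (cases "src (nearest p)") auto
    then have "j < state_dim S"
      using src_Inr[OF _ j(1)] state_less nearest(1) cycle by (auto simp: edge_State_State)
    then show ?thesis
      using j(2) cov by (simp add: nodes_def)
  qed
  show "rk (cell x) < rk r" if r: "r \<in> cells" "par r = Inr x" for r x
    using r(1)
  proof (cases rule: cells_cases)
    case (stem p i)
    then show ?thesis
      using par_stem_edge(2)[of p i x] r(2) by (cases x) (auto simp del: par.simps)
  next
    case (cycle p)
    then obtain j where j: "src (nearest p) = Inr j" "x = (j, cov j)"
      using r(2) by (cases "src (nearest p)") auto
    have near: "nearest p < state_dim S"
      using state_less nearest(1) cycle by auto
    then have "j < state_dim S"
      using src_Inr[OF _ j(1)] by (auto simp: edge_State_State)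
    note cov_j = cov[OF this]
    show ?thesis
    proof (cases "stem S (cov j)")
      case True
      have "first_index (cov j) (State j) < length (cov j)"
        by (rule first_index(2)[OF cov_j(2)])
      also have "\<dots> \<le> (\<Sum>q\<in>P. length q)"
        using fin_P cov_j(1) by (intro member_le_sum) auto
      finally show ?thesis
        using True j cycle by simp
    next
      case False
      then have "dist (nearest (cov j)) \<le> dist j"
        using nearest(2)[OF cov_j(1)] members cov_j by blast
      then show ?thesis
        using src_dist[OF near j(1)] False j cycle by simp
    qed
  qed
  show "0 \<le> wt r" for r
    by (cases r rule: wt.cases) auto
  show "r = r'" if r: "r \<in> cells" "r' \<in> cells" "wt r = wt r'" "0 < wt r" for r r'
  proof -
    have pos: "0 < wt r'"
      using r(3,4) by simp
    obtain p where p: "r = (p, None)" "p \<in> P"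
      using r(1,4) by (rule cycle_cell)
    obtain q where q: "r' = (q, None)" "q \<in> P"
      using r(2) pos by (rule cycle_cell)
    have "code p = code q"
      using r(3) p(1) q(1) by simp
    then show ?thesis
      using inj_onD[OF code_inj] p q by simp
  qed
  show "x = y" if "x \<in> nodes" "y \<in> nodes" "cell x = cell y" "wt (cell x) = 0" for x y
    using that by (cases x; cases y) (auto split: if_splits)
  show "wt (cell x) = 0" if "r \<in> cells" "wt r = 0" "par r = Inr x" for r x
    using that(1)
  proof (cases rule: cells_cases)
    case (stem p i)
    then show ?thesis
      using par_stem_edge(2)[of p i x] that(3) by (cases x) (auto simp del: par.simps)
  next
    case (cycle p)
    then show ?thesis using that(2) by simp
  qed
  show "r = r'" if r: "r \<in> cells" "r' \<in> cells" "wt r = 0" "wt r' = 0" "par r = par r'" for r r'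
  proof -
    obtain p i where p: "r = (p, Some i)" "p \<in> P" "stem S p" "State i \<in> set p"
      using r(1,3) by (rule stem_cell)
    obtain q j where q: "r' = (q, Some j)" "q \<in> P" "stem S q" "State j \<in> set q"
      using r(2,4) by (rule stem_cell)
    obtain k where k: "first_index p (State i) = Suc k" "Suc k < length p" "p ! Suc k = State i"
      using stem_first_index[OF p(3,4)] by blast
    obtain l where l: "first_index q (State j) = Suc l" "Suc l < length q" "q ! Suc l = State j"
      using stem_first_index[OF q(3,4)] by blast
    have par_p: "par r = (case p ! k of Input s \<Rightarrow> Inl s | State j \<Rightarrow> Inr (j, p))"
      and par_q: "par r = (case q ! l of Input s \<Rightarrow> Inl s | State j \<Rightarrow> Inr (j, q))"
      using p(1) q(1) k(1) l(1) r(5) by simp_all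
    \<comment> \<open>A common input parent forces equal stems by \<open>stems\<close>; a common
      state parent carries its stem as second component.\<close>
    have pq: "p = q \<and> p ! k = p ! l"
    proof (cases "par r")
      case (Inl s)
      then have "p ! k = Input s" "q ! l = Input s"
        using par_p par_q by (auto split: node.splits)
      moreover have "state_index (hd p) = state_index (hd q)"
        using par_stem_edge(1)[OF p(3,4), of s] par_stem_edge(1)[OF q(3,4), of s] Inl p(1) q(1) r(5)
        by (simp del: par.simps)
      note pk = calculation and hd = this
      have "hd p = hd q"
        using hd p(3) q(3) by (auto simp: stem_def)
      then have "p = q"
        using stems p q by blast
      then show ?thesis
        using pk by simp
    next
      case (Inr x)
      then show ?thesis
        using par_p par_q by (auto split: node.splits)
    qed
    moreover have "distinct p"
      using p(3) by (simp add: stem_def vpath_def)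
    ultimately have "k = l"
      using k(2) l(2) by (metis Suc_lessD nth_eq_iff_index_eq)
    then show ?thesis
      using pq p(1) q(1) k(3) l(3) by simp
  qed
qed

text \<open>Nonzero weights occur only on edges of the original graph; this makes the weight matrix
  a realisation of the split system.\<close>

lemma state_weight_edge:
  assumes "x \<in> nodes" "y \<in> nodes" "state_weight y x \<noteq> 0"
  shows "Amat S $$ (fst y, fst x) = Free"
proof -
  from assms(3) consider "y = nx x" "wt (cell x) \<noteq> 0" | "y = ent (cell y)" "par (cell y) = Inr x"
    by (auto simp: state_weight_def split: if_splits)
  then have "edge S (State (fst x)) (State (fst y))"
  proof cases
    case 1
    then show ?thesis using nx_edge(1)[OF assms(1)] by simp
  next
    case 2
    then show ?thesis
      using par_Inr_edge[of "cell y" x] cell_in[OF assms(2)] by metis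
  qed
  then show ?thesis
    by (simp add: edge_State_State)
qed

lemma input_weight_edge:
  assumes "y \<in> nodes" "input_weight y s \<noteq> 0"
  shows "Bmat S $$ (fst y, s) = Free"
proof -
  have "y = ent (cell y)" "par (cell y) = Inl s"
    using assms(2) by (auto simp: input_weight_def split: if_splits)
  then have "edge S (Input s) (State (fst y))"
    using par_Inl_edge[of "cell y" s] cell_in[OF assms(1)] by metis
  then show ?thesis
    by (simp add: edge_Input_State)
qed

end

section \<open>Splitting the states\<close>

text \<open>The blocks are consecutive intervals: partial sums separate different blocks, and
  induction on \<open>n\<close> locates each index in one.\<close>

lemma block_index_bij:
  "bij_betw (\<lambda>(i, k). block_index d i k) (SIGMA i:{..<n}. {..<d i}) {..<\<Sum>i<n. d i}"
proof (rule bij_betwI')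
  have less: "block_index d i k < block_index d j l" if "i < j" "k < d i" for i j k l
  proof -
    have "block_index d i k < (\<Sum>m<Suc i. d m)"
      using that by (simp add: block_index_def)
    also have "\<dots> \<le> (\<Sum>m<j. d m)"
      using that by (intro sum_mono2) auto
    also have "\<dots> \<le> block_index d j l"
      by (simp add: block_index_def)
    finally show ?thesis .
  qed
  fix x y assume "x \<in> (SIGMA i:{..<n}. {..<d i})" "y \<in> (SIGMA i:{..<n}. {..<d i})"
  then obtain i k j l where xy: "x = (i, k)" "y = (j, l)" "k < d i" "l < d j"
    by auto
  consider "i < j" | "i = j" | "j < i" by linarith
  then show "((case x of (i, k) \<Rightarrow> block_index d i k) = (case y of (i, k) \<Rightarrow> block_index d i k)) = (x = y)"
  proof cases
    case 1
    then show ?thesis using less[of i j k l] xy by simp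
  next
    case 2
    then show ?thesis using xy by (simp add: block_index_def)
  next
    case 3
    then show ?thesis using less[of j i l k] xy by simp
  qed
next
  fix x assume "x \<in> (SIGMA i:{..<n}. {..<d i})"
  then obtain i k where x: "x = (i, k)" "i < n" "k < d i" by auto
  have "block_index d i k < (\<Sum>m<Suc i. d m)"
    using x by (simp add: block_index_def)
  also have "\<dots> \<le> (\<Sum>m<n. d m)"
    using x by (intro sum_mono2) auto
  finally show "(case x of (i, k) \<Rightarrow> block_index d i k) \<in> {..<\<Sum>i<n. d i}"
    using x by simp
next
  fix a assume "a \<in> {..<\<Sum>i<n. d i}"
  then have "a < (\<Sum>i<n. d i)" by simp
  then have "\<exists>i<n. \<exists>k<d i. a = block_index d i k"
  proof (induction n)
    case (Suc n)
    show ?case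
    proof (cases "a < (\<Sum>i<n. d i)")
      case True
      then show ?thesis using Suc.IH less_Suc_eq by metis
    next
      case False
      then have "a - (\<Sum>i<n. d i) < d n" "a = block_index d n (a - (\<Sum>i<n. d i))"
        using Suc.prems by (auto simp: block_index_def)
      then show ?thesis by blast
    qed
  qed simp
  then show "\<exists>x\<in>SIGMA i:{..<n}. {..<d i}. a = (case x of (i, k) \<Rightarrow> block_index d i k)"
    by force
qed

section \<open>The split system\<close>

text \<open>Every copy inherits all edges of its state, so the blocks are as free as an extension
  permits; the diagonal blocks vanish because an original network has zero diagonal.\<close>

definition splitting :: "structured_system \<Rightarrow> (nat \<Rightarrow> nat) \<Rightarrow> (nat \<Rightarrow> nat) \<Rightarrow> structured_system" where
  "splitting S d \<phi> = (let n = state_dim S; N = (\<Sum>i<n. d i) in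
     \<lparr> Amat = mat N N (\<lambda>(a, b). Amat S $$ (\<phi> a, \<phi> b)),
       Bmat = mat N (input_dim S) (\<lambda>(a, s). Bmat S $$ (\<phi> a, s)),
       Cmat = mat n N (\<lambda>(i, a). if i \<noteq> \<phi> a then Fixed 0 else if d i > 1 then Free else Fixed 1) \<rparr>)"

text \<open>\<open>\<phi>\<close> gives the state of which an index is a copy,
  \<open>\<kappa>\<close> the number of the copy; together they invert
  \<open>block_index\<close>.\<close>

locale state_splitting =
  fixes S :: structured_system and d \<phi> \<kappa> :: "nat \<Rightarrow> nat"
  assumes orig: "original_network S"
    and d_pos: "i < state_dim S \<Longrightarrow> 1 \<le> d i"
    and owner: "i < state_dim S \<Longrightarrow> k < d i \<Longrightarrow> \<phi> (block_index d i k) = i"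
    and copy: "i < state_dim S \<Longrightarrow> k < d i \<Longrightarrow> \<kappa> (block_index d i k) = k"
begin

abbreviation "N \<equiv> (\<Sum>i<state_dim S. d i)"

lemma block_index_less:
  assumes "i < state_dim S" "k < d i"
  shows "block_index d i k < N"
  using bij_betw_apply[OF block_index_bij, of "(i, k)" "state_dim S" d] assms by simp

lemma block_index_cases:
  assumes "a < N"
  obtains i k where "i < state_dim S" "k < d i" "a = block_index d i k"
proof -
  have "a \<in> (\<lambda>(i, k). block_index d i k) ` (SIGMA i:{..<state_dim S}. {..<d i})"
    using block_index_bij[of d "state_dim S"] assms by (simp add: bij_betw_def)
  then show thesis using that by auto
qed

lemma owner_less:
  assumes "a < N"
  shows "\<phi> a < state_dim S"
proof -
  obtain i k where "i < state_dim S" "k < d i" "a = block_index d i k"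
    using assms by (rule block_index_cases)
  then show ?thesis by (simp only: owner)
qed

lemma original:
  shows "i < state_dim S \<Longrightarrow> j < state_dim S \<Longrightarrow> Amat S $$ (i, j) \<in> {Fixed 0, Free}"
    and "i < state_dim S \<Longrightarrow> Amat S $$ (i, i) = Fixed 0"
    and "i < state_dim S \<Longrightarrow> s < input_dim S \<Longrightarrow> Bmat S $$ (i, s) \<in> {Fixed 0, Free}"
  using orig unfolding original_network_def Let_def by blast+

lemma splitting_carrier:
  "Amat (splitting S d \<phi>) \<in> carrier_mat N N"
  "Bmat (splitting S d \<phi>) \<in> carrier_mat N (input_dim S)"
  "Cmat (splitting S d \<phi>) \<in> carrier_mat (state_dim S) N"
  by (simp_all add: splitting_def Let_def)

lemma splitting_entry:
  "a < N \<Longrightarrow> b < N \<Longrightarrow> Amat (splitting S d \<phi>) $$ (a, b) = Amat S $$ (\<phi> a, \<phi> b)"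
  "a < N \<Longrightarrow> s < input_dim S \<Longrightarrow> Bmat (splitting S d \<phi>) $$ (a, s) = Bmat S $$ (\<phi> a, s)"
  "i < state_dim S \<Longrightarrow> a < N \<Longrightarrow> Cmat (splitting S d \<phi>) $$ (i, a) =
     (if i \<noteq> \<phi> a then Fixed 0 else if d i > 1 then Free else Fixed 1)"
  by (simp_all add: splitting_def Let_def)

lemma extended: "extended_system S d (splitting S d \<phi>)"
  unfolding extended_system_def Let_def
proof (intro conjI allI impI)
  fix i assume i: "i < state_dim S"
  show "1 \<le> d i" by (rule d_pos[OF i])
  show "(\<forall>k<d i. \<forall>l<d i. Amat (splitting S d \<phi>) $$ (block_index d i k, block_index d i l) = Free) \<or>
        (\<forall>k<d i. \<forall>l<d i. Amat (splitting S d \<phi>) $$ (block_index d i k, block_index d i l) = Fixed 0)"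
    using original(2)[OF i] by (simp add: splitting_entry block_index_less owner i)
  fix k assume k: "k < d i"
  show "Amat (splitting S d \<phi>) $$ (block_index d i k, block_index d j l)
      \<in> (if Amat S $$ (i, j) = Free then {Fixed 0, Free} else {Fixed 0})"
    if "j < state_dim S" "l < d j" for j l
    using original(1)[OF i that(1)] by (auto simp: splitting_entry block_index_less owner i k that)
  show "Bmat (splitting S d \<phi>) $$ (block_index d i k, s)
      \<in> (if Bmat S $$ (i, s) = Free then {Fixed 0, Free} else {Fixed 0})" if "s < input_dim S" for s
    using original(3)[OF i that] by (auto simp: splitting_entry block_index_less owner i k that)
next
  fix i j l assume "i < state_dim S" "j < state_dim S" "l < d j"
  then show "Cmat (splitting S d \<phi>) $$ (i, block_index d j l)
      = (if i \<noteq> j then Fixed 0 else if 1 < d j then Free else Fixed 1)"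
    by (simp add: splitting_entry block_index_less owner)
qed (rule splitting_carrier)+

lemma homogeneous: "homogeneous_internal_dynamics S d (splitting S d \<phi>)"
  unfolding homogeneous_internal_dynamics_def
  by (simp add: splitting_entry block_index_less owner original(2))

text \<open>For the output, a left kernel vector \<open>u\<close> of \<open>C * ?R\<close> gives the
  left kernel vector C^T u of \<open>?R\<close>, which is zero; since \<open>C\<close> has full row
  rank, \<open>u\<close> is zero.\<close>

lemma controllable:
  fixes A B :: "real mat"
  assumes A: "A \<in> carrier_mat N N" and B: "B \<in> carrier_mat N (input_dim S)"
    and A_edge: "\<And>a b. a < N \<Longrightarrow> b < N \<Longrightarrow> A $$ (a, b) \<noteq> 0 \<Longrightarrow> Amat S $$ (\<phi> a, \<phi> b) = Free"
    and B_edge: "\<And>a s. a < N \<Longrightarrow> s < input_dim S \<Longrightarrow> B $$ (a, s) \<noteq> 0 \<Longrightarrow> Bmat S $$ (\<phi> a, s) = Free"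
    and eig: "Hautus_condition A B"
  shows "structurally_controllable (splitting S d \<phi>)"
    and "structurally_output_controllable (splitting S d \<phi>)"
proof -
  let ?E = "splitting S d \<phi>" and ?n = "state_dim S" and ?m = "input_dim S"
  let ?R = "controllability_matrix A B"
  have A_real: "A \<in> realizations (Amat ?E)"
    unfolding realizations_def
  proof (intro CollectI conjI allI impI)
    show "A \<in> carrier_mat (dim_row (Amat ?E)) (dim_col (Amat ?E))"
      using A splitting_carrier(1) by simp
    fix a b c
    assume "a < dim_row (Amat ?E)" "b < dim_col (Amat ?E)" and c: "Amat ?E $$ (a, b) = Fixed c"
    then have ab: "a < N" "b < N"
      using splitting_carrier(1) by simp_all
    then show "A $$ (a, b) = c"
      using c A_edge[OF ab] original(1)[of "\<phi> a" "\<phi> b"]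
      by (auto simp: splitting_entry owner_less)
  qed
  have B_real: "B \<in> realizations (Bmat ?E)"
    unfolding realizations_def
  proof (intro CollectI conjI allI impI)
    show "B \<in> carrier_mat (dim_row (Bmat ?E)) (dim_col (Bmat ?E))"
      using B splitting_carrier(2) by simp
    fix a s c
    assume "a < dim_row (Bmat ?E)" "s < dim_col (Bmat ?E)" and c: "Bmat ?E $$ (a, s) = Fixed c"
    then have as: "a < N" "s < ?m"
      using splitting_carrier(2) by simp_all
    then show "B $$ (a, s) = c"
      using c B_edge[OF as] original(3)[of "\<phi> a" s]
      by (auto simp: splitting_entry owner_less)
  qed
  have R: "?R \<in> carrier_mat N (N * ?m)"
    using A B by (simp add: controllability_matrix_def Let_def)
  have ker: "u = 0\<^sub>v N" if "u \<in> carrier_vec N" "?R\<^sup>T *\<^sub>v u = 0\<^sub>v (N * ?m)" for u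
    by (rule Hautus_left_kernel[OF A B eig that])
  have R_dims: "dim_row ?R = N" "dim_col ?R = N * ?m"
    using R by auto
  have "full_row_rank ?R"
    by (rule full_row_rankI) (simp only: R_dims ker)
  then show "structurally_controllable ?E"
    using A_real B_real by (auto simp: structurally_controllable_def)
  define C where "C = mat ?n N (\<lambda>(i, a). if \<phi> a = i \<and> \<kappa> a = 0 then 1 else (0::real))"
  have C: "C \<in> carrier_mat ?n N"
    by (simp add: C_def)
  have \<kappa>_0: "\<kappa> a = 0" if a: "a < N" "\<not> 1 < d (\<phi> a)" for a
  proof -
    obtain i k where "i < ?n" "k < d i" "a = block_index d i k"
      using a(1) by (rule block_index_cases)
    then show ?thesis
      using a(2) by (simp add: owner copy)
  qed
  have C_real: "C \<in> realizations (Cmat ?E)"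
    unfolding realizations_def
  proof (intro CollectI conjI allI impI)
    show "C \<in> carrier_mat (dim_row (Cmat ?E)) (dim_col (Cmat ?E))"
      using C splitting_carrier(3) by simp
    fix i a c
    assume "i < dim_row (Cmat ?E)" "a < dim_col (Cmat ?E)" and c: "Cmat ?E $$ (i, a) = Fixed c"
    then have ia: "i < ?n" "a < N"
      using splitting_carrier(3) by simp_all
    then show "C $$ (i, a) = c"
      using c \<kappa>_0[of a] by (auto simp: splitting_entry C_def split: if_splits)
  qed
  have "full_row_rank (C * ?R)"
  proof (rule full_row_rankI)
    fix u :: "real vec"
    assume "u \<in> carrier_vec (dim_row (C * ?R))" "(C * ?R)\<^sup>T *\<^sub>v u = 0\<^sub>v (dim_col (C * ?R))"
    then have u: "u \<in> carrier_vec ?n" and "?R\<^sup>T * C\<^sup>T *\<^sub>v u = 0\<^sub>v (N * ?m)"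
      using C R transpose_mult[OF C R] by auto
    then have "?R\<^sup>T *\<^sub>v (C\<^sup>T *\<^sub>v u) = 0\<^sub>v (N * ?m)"
      using assoc_mult_mat_vec[of "?R\<^sup>T" "N * ?m" N "C\<^sup>T" ?n u] C R by simp
    then have zero: "C\<^sup>T *\<^sub>v u = 0\<^sub>v N"
      using C u by (intro ker) auto
    show "u = 0\<^sub>v (dim_row (C * ?R))"
    proof (rule eq_vecI)
      fix i assume "i < dim_vec (0\<^sub>v (dim_row (C * ?R)) :: real vec)"
      then have i: "i < ?n" using C by simp
      let ?a = "block_index d i 0"
      have d: "0 < d i"
        using d_pos[OF i] by simp
      have a: "?a < N" "\<phi> ?a = i" "\<kappa> ?a = 0"
        using block_index_less[OF i d] owner[OF i d] copy[OF i d] by auto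
      have "0 = (C\<^sup>T *\<^sub>v u) $ ?a"
        using zero a(1) by simp
      also have "\<dots> = (\<Sum>j<?n. C $$ (j, ?a) * u $ j)"
        using a(1) C u by (simp add: scalar_prod_def atLeast0LessThan)
      also have "\<dots> = (\<Sum>j<?n. if j = i then u $ j else 0)"
        using a by (intro sum.cong) (auto simp: C_def)
      finally show "u $ i = 0\<^sub>v (dim_row (C * ?R)) $ i"
        using i C by simp
    qed (use u C in auto)
  qed
  then show "structurally_output_controllable ?E"
    using A_real B_real C_real by (auto simp: structurally_output_controllable_def)
qed

end

section \<open>Transport of the forest to the split system\<close>

context stem_cycle_cover
begin

lemma exists_controllable_splitting:
  assumes orig: "original_network S"
  shows "\<exists>d E. extended_system S d E \<and> homogeneous_internal_dynamics S d E \<and>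
           structurally_controllable E \<and> structurally_output_controllable E"
proof -
  let ?n = "state_dim S" and ?m = "input_dim S"
  \<comment> \<open>One copy of state \<open>i\<close> for each chosen member through it;
    \<open>g i\<close> will enumerate these members.\<close>
  define d where "d i = card {p \<in> P. State i \<in> set p}" for i
  have "\<exists>g. bij_betw g {..<d i} {p \<in> P. State i \<in> set p}" for i
    using ex_bij_betw_nat_finite[of "{p \<in> P. State i \<in> set p}"] fin_P
    by (auto simp: d_def atLeast0LessThan)
  then obtain g where g: "\<And>i. bij_betw (g i) {..<d i} {p \<in> P. State i \<in> set p}"
    by metis
  let ?I = "SIGMA i:{..<?n}. {..<d i}" and ?N = "\<Sum>i<?n. d i"
  define \<beta> where "\<beta> = inv_into ?I (\<lambda>(i, k). block_index d i k)"
  have \<beta>: "\<beta> (block_index d i k) = (i, k)" if "i < ?n" "k < d i" for i k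
    using bij_betw_inv_into_left[OF block_index_bij, of "(i, k)" ?n d] that by (simp add: \<beta>_def)
  have \<beta>_bij: "bij_betw \<beta> {..<?N} ?I"
    unfolding \<beta>_def by (rule bij_betw_inv_into[OF block_index_bij])
  interpret state_splitting S d "fst \<circ> \<beta>" "snd \<circ> \<beta>"
  proof
    show "1 \<le> d i" if "i < ?n" for i
    proof -
      have "{p \<in> P. State i \<in> set p} \<noteq> {}"
        using cov that by blast
      then show ?thesis
        using fin_P by (simp add: d_def Suc_le_eq card_gt_0_iff)
    qed
  qed (simp_all add: orig \<beta>)
  \<comment> \<open>\<open>h\<close> identifies a matrix index with a node of the forest: the state
    and the member to which this copy belongs.\<close>
  define h where "h = (\<lambda>a. (fst (\<beta> a), g (fst (\<beta> a)) (snd (\<beta> a))))"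
  have "bij_betw (\<lambda>(i, k). (i, g i k)) ?I nodes"
  proof (rule bij_betw_imageI)
    show "inj_on (\<lambda>(i, k). (i, g i k)) ?I"
      using g by (auto simp: inj_on_def bij_betw_def)
    have "(i, p) \<in> (\<lambda>(i, k). (i, g i k)) ` ?I" if "(i, p) \<in> nodes" for i p
    proof -
      have p: "p \<in> P" "State i \<in> set p"
        using that by (auto simp: nodes_def)
      then obtain k where "k < d i" "p = g i k"
        using g[of i] by (force simp: bij_betw_def)
      then show ?thesis
        using state_less[OF p] by force
    qed
    moreover have "(i, g i k) \<in> nodes" if "k < d i" for i k
      using bij_betw_apply[OF g, of k i] that by (simp add: nodes_def)
    ultimately show "(\<lambda>(i, k). (i, g i k)) ` ?I = nodes"
      by auto
  qed
  from bij_betw_trans[OF \<beta>_bij this] have h: "bij_betw h {..<?N} nodes"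
    by (simp add: h_def comp_def case_prod_unfold)
  have h_fst: "fst (h a) = (fst \<circ> \<beta>) a" for a
    by (simp add: h_def)
  have h_nodes: "h a \<in> nodes" if "a < ?N" for a
    using bij_betw_apply[OF h] that by simp
  define A where "A = mat ?N ?N (\<lambda>(a, b). state_weight (h a) (h b))"
  define B where "B = mat ?N ?m (\<lambda>(a, s). input_weight (h a) s)"
  have A: "A \<in> carrier_mat ?N ?N" and B: "B \<in> carrier_mat ?N ?m"
    by (simp_all add: A_def B_def)
  have A_edge: "Amat S $$ ((fst \<circ> \<beta>) a, (fst \<circ> \<beta>) b) = Free" if "a < ?N" "b < ?N" "A $$ (a, b) \<noteq> 0" for a b
    using state_weight_edge[of "h b" "h a"] h_nodes that by (simp add: A_def h_fst)
  have B_edge: "Bmat S $$ ((fst \<circ> \<beta>) a, s) = Free" if "a < ?N" "s < ?m" "B $$ (a, s) \<noteq> 0" for a s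
    using input_weight_edge[of "h a" s] h_nodes that by (simp add: B_def h_fst)
  have eig: "Hautus_condition A B"
    unfolding Hautus_condition_def carrier_matD(1)[OF A] carrier_matD(2)[OF B]
  proof (intro allI impI, elim conjE)
    fix v :: "nat \<Rightarrow> complex" and \<mu> x
    assume state: "\<forall>x<?N. (\<Sum>y<?N. v y * complex_of_real (A $$ (y, x))) = \<mu> * v x"
      and input: "\<forall>s<?m. (\<Sum>y<?N. v y * complex_of_real (B $$ (y, s))) = 0"
      and x: "x < ?N"
    define h' where "h' = inv_into {..<?N} h"
    have h': "h' (h y) = y" if "y < ?N" for y
      using bij_betw_inv_into_left[OF h] that by (simp add: h'_def)
    have h'_less: "h' y < ?N" and hh': "h (h' y) = y" if "y \<in> nodes" for y
      using bij_betw_apply[OF bij_betw_inv_into[OF h] that] bij_betw_inv_into_right[OF h that]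
      by (simp_all add: h'_def)
    have transfer: "(\<Sum>y\<in>nodes. v (h' y) * w y) = (\<Sum>y<?N. v y * w (h y))" for w
      using sum.reindex_bij_betw[OF h, of "\<lambda>y. v (h' y) * w y"] h' by simp
    \<comment> \<open>Along \<open>h\<close> the matrix equations become those of the
      forest.\<close>
    have "v (h' (h x)) = 0"
    proof (rule left_eigenvector_zero[of "\<lambda>y. v (h' y)" \<mu>])
      fix z assume z: "z \<in> nodes"
      show "(\<Sum>y\<in>nodes. v (h' y) * state_weight y z) = \<mu> * v (h' z)"
        unfolding transfer state[rule_format, OF h'_less[OF z], symmetric]
        using h'_less[OF z] hh'[OF z] by (intro sum.cong) (auto simp: A_def)
    next
      fix r s assume "r \<in> cells" "par r = Inl s"
      then have s: "s < ?m"
        using par_Inl_edge by (simp add: edge_Input_State)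
      show "(\<Sum>y\<in>nodes. v (h' y) * input_weight y s) = 0"
        unfolding transfer input[rule_format, OF s, symmetric]
        using s by (intro sum.cong) (auto simp: B_def)
    qed (use h_nodes x in blast)
    then show "v x = 0"
      using h' x by simp
  qed
  note ctrl = controllable[OF A B A_edge B_edge eig]
  show ?thesis
    using extended homogeneous ctrl by blast
qed

end

theorem corollary2:
  fixes S :: structured_system
  assumes "X_network S"
  shows "\<exists>d E. extended_system S d E \<and> homogeneous_internal_dynamics S d E \<and>
           structurally_controllable E \<and> structurally_output_controllable E"
proof -
  let ?n = "state_dim S"
  obtain P where orig: "original_network S" and acc: "input_accessible S"
    and P: "\<And>p. p \<in> P \<Longrightarrow> stem S p \<or> cycle S p" "covers P (State ` {..<?n})"
      "\<not> stems_from_same_input S P"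
    using assms unfolding X_network_def by blast
  have "\<forall>i\<in>{..<?n}. \<exists>p\<in>P. State i \<in> set p"
    using P(2) by (auto simp: covers_def)
  \<comment> \<open>Keeping one member per state gives a finite cover, and a subfamily inherits that
    distinct stems start at distinct inputs.\<close>
  then obtain cov where cov: "\<And>i. i < ?n \<Longrightarrow> cov i \<in> P \<and> State i \<in> set (cov i)"
    by (metis lessThan_iff)
  let ?P = "cov ` {..<?n}"
  obtain code :: "node list \<Rightarrow> nat" where code: "inj_on code ?P"
    using finite_imp_inj_to_nat_seg[of ?P] by auto
  obtain dist :: "nat \<Rightarrow> nat" where dist: "\<And>i. i < ?n \<Longrightarrow> (\<exists>s. edge S (Input s) (State i)) \<or>
       (\<exists>j. edge S (State j) (State i) \<and> dist j < dist i)"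
    using input_accessible_distance[OF acc] by auto
  \<comment> \<open>The admissible sources of an edge into \<open>i\<close>: an input, or a state of
    smaller distance.\<close>
  define entry where "entry i x = (case x of Inl s \<Rightarrow> edge S (Input s) (State i)
      | Inr j \<Rightarrow> edge S (State j) (State i) \<and> dist j < dist i)" for i x
  define src where "src i = (SOME x. entry i x)" for i
  have src: "entry i (src i)" if "i < ?n" for i
    unfolding src_def
  proof (rule someI_ex)
    from dist[OF that] show "\<exists>x. entry i x"
    proof (elim disjE exE)
      fix s assume "edge S (Input s) (State i)"
      then have "entry i (Inl s)"
        by (simp add: entry_def)
      then show ?thesis ..
    next
      fix j assume "edge S (State j) (State i) \<and> dist j < dist i"
      then have "entry i (Inr j)"
        by (simp add: entry_def)
      then show ?thesis ..
    qed
  qed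
  interpret stem_cycle_cover S ?P code dist src cov
  proof
    show "finite ?P" by simp
    show "inj_on code ?P" by (rule code)
    show "stem S p \<or> cycle S p" if "p \<in> ?P" for p
      using that cov P(1) by blast
    show "p = q" if "p \<in> ?P" "q \<in> ?P" "stem S p" "stem S q" "hd p = hd q" for p q
      using that cov P(3) unfolding stems_from_same_input_def by blast
    show "edge S (Input s) (State i)" if "i < ?n" "src i = Inl s" for i s
      using src[OF that(1)] by (simp add: that(2) entry_def)
    show "edge S (State j) (State i)" "dist j < dist i" if "i < ?n" "src i = Inr j" for i j
      using src[OF that(1)] by (simp_all add: that(2) entry_def)
    show "cov i \<in> ?P" "State i \<in> set (cov i)" if "i < ?n" for i
      using that cov by auto
  qed
  show ?thesis
    by (rule exists_controllable_splitting[OF orig])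
qed

end
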